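(* Let $W$ be the smooth part of the fundamental solution of $u_t=\int_{\mathbb R^N}J(x-y)(u(y,t)-u(x,t))\,dy$. There exists a constant $C>0$ depending only on $J$ and $N$ such that $$|\nabla W(x,t)|\le C\,\frac{t}{|x|^{N+3}}\qquad\text{for all }x\in\mathbb R^N\setminus\{0\},\ t>0,$$ where $\nabla$ is the gradient in $x$.
   Context: $J\in C_0^\infty(\mathbb R^N)$ is radially symmetric, $J\ge0$, $\int J=1$. The fundamental solution of $u_t=Lu$, $Lu(x,t)=\int J(x-y)(u(y,t)-u(x,t))\,dy$, can be written as $e^{-t}\delta+W(x,t)$, where $\delta$ is the Dirac measure at the origin and $W$ is a smooth function. Equivalently, $W$ is the solution (bounded on finite time intervals) of $W_t(x,t)=\int J(x-y)\big(W(y,t)-W(x,t)\big)\,dy+e^{-t}J(x)$ in $\mathbb R^N\times(0,\infty)$, $W(x,0)=0$. *)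

theory Defs
  imports "HOL-Analysis.Analysis"
begin

text \<open>
  \<open>C_k_on k S f\<close>: all iterated directional derivatives of \<open>f\<close> up to order \<open>k\<close> exist and are
  continuous on \<open>S\<close>. Derivatives are taken with \<open>at x\<close>, not \<open>at x within S\<close>, so the notion is
  intended for open \<open>S\<close>.
\<close>

primrec C_k_on :: "nat \<Rightarrow> 'a::euclidean_space set \<Rightarrow> ('a \<Rightarrow> real) \<Rightarrow> bool" where
  "C_k_on 0 S f \<longleftrightarrow> continuous_on S f"
| "C_k_on (Suc k) S f \<longleftrightarrow>
     (\<forall>x\<in>S. f differentiable (at x)) \<and>
     (\<forall>v. C_k_on k S (\<lambda>x. frechet_derivative f (at x) v))"

definition smooth_on :: "'a::euclidean_space set \<Rightarrow> ('a \<Rightarrow> real) \<Rightarrow> bool" where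
  "smooth_on S f \<longleftrightarrow> (\<forall>k. C_k_on k S f)"

definition smooth_compact_support :: "('a::euclidean_space \<Rightarrow> real) \<Rightarrow> bool" where
  "smooth_compact_support f \<longleftrightarrow> smooth_on UNIV f \<and> compact (closure {x. f x \<noteq> 0})"

definition radially_symmetric :: "('a::real_normed_vector \<Rightarrow> real) \<Rightarrow> bool" where
  "radially_symmetric f \<longleftrightarrow> (\<forall>x y. norm x = norm y \<longrightarrow> f x = f y)"

definition nonlocal_op :: "('a::euclidean_space \<Rightarrow> real) \<Rightarrow> ('a \<Rightarrow> real) \<Rightarrow> 'a \<Rightarrow> real" where
  "nonlocal_op J u x = (LINT y|lborel. J (x - y) * (u y - u x))"

text \<open>
  The fundamental solution of \<open>u\<^sub>t = L u\<close>, with \<open>L = nonlocal_op J\<close>, has the form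
  \<open>exp (-t) \<delta> + W(\<cdot>, t)\<close>. Since \<open>\<integral>J = 1\<close> gives \<open>L \<delta> = J - \<delta>\<close>, inserting this into the equation
  with initial datum \<open>\<delta>\<close> leaves \<open>W\<^sub>t = L W + exp (-t) J\<close>, \<open>W(\<cdot>, 0) = 0\<close>. The predicate below says
  that \<open>W\<close> is the solution of this problem that is bounded on finite time intervals. Only the
  values of \<open>W\<close> at times \<open>t \<ge> 0\<close> are constrained.
\<close>

definition fundamental_smooth_part ::
    "('a::euclidean_space \<Rightarrow> real) \<Rightarrow> ('a \<Rightarrow> real \<Rightarrow> real) \<Rightarrow> bool" where
  "fundamental_smooth_part J W \<longleftrightarrow>
     smooth_on (UNIV \<times> {0<..}) (\<lambda>(x, t). W x t) \<and>
     continuous_on (UNIV \<times> {0..}) (\<lambda>(x, t). W x t) \<and>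
     (\<forall>T>0. bounded ((\<lambda>(x, t). W x t) ` (UNIV \<times> {0..T}))) \<and>
     (\<forall>x. \<forall>t>0. ((\<lambda>s. W x s) has_real_derivative
                    nonlocal_op J (\<lambda>y. W y t) x + exp (- t) * J x) (at t)) \<and>
     (\<forall>x. W x 0 = 0)"

end

theory Submission imports Defs begin

text \<open>
  Duhamel iteration gives \<open>exp t * W x t = \<Sum>k. t ^ (k + 1) / (k + 1)! * J\<^sub>k x\<close>, where \<open>J\<^sub>k\<close> is the
  \<open>k + 1\<close>-fold convolution power of \<open>J\<close>, so it suffices to bound the gradient of \<open>J\<^sub>k\<close> by
  \<open>C (k + 1) / \<bar>x\<bar> ^ (N + 3)\<close>. Split \<open>J\<close> as
  \<open>(G(x - a) + G(x + a)) / 2 + H(x)\<close> with \<open>G, H\<close> even and nonnegative. Conditionally on everything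
  else, \<open>J\<^sub>k\<close> is then a simple random walk in the direction \<open>a\<close>, for which
  \<open>(\<delta>\<^sub>1 - \<delta>\<^sub>-\<^sub>1) * p\<^sub>j\<close> is the measure \<open>m \<mapsto> 2 m / (j + 1) * p\<^sub>j\<^sub>+\<^sub>1(m)\<close>. Unimodality of \<open>p\<^sub>j\<close>
  bounds \<open>\<bar>m\<bar> p\<^sub>j(m)\<close> and \<open>\<bar>m\<bar>\<^sup>5 p\<^sub>j(m)\<close> pointwise, and a line in direction \<open>a\<close> meets a sector of the
  shell \<open>r \<le> \<bar>x\<bar> \<le> r + 1\<close> around \<open>a\<close> in boundedly many points of each progression of step \<open>a\<close>;
  with second and fourth moments of the remaining factors, the increments of \<open>J\<^sub>k\<close> are at most
  \<open>C (k + 1) / r ^ 4\<close> in \<open>L\<^sup>1\<close> of that sector. Since \<open>J\<^sub>k\<close> is radial and the sector has volume at least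
  \<open>c r ^ (N - 1)\<close>, this gives the pointwise gradient bound for \<open>J\<^sub>k\<^sub>+\<^sub>1 = J * J\<^sub>k\<close>.
\<close>

subsection \<open>Simple random walk\<close>

text \<open>The estimate must be uniform in \<open>k\<close> and \<open>x\<close> at every ratio of
  the norm of \<open>x\<close> to the diffusive scale sqrt \<open>k\<close>, so exact identities and
  moments take the place of a limit theorem. The powers balance as follows: fourth moments give
  (k+1)^2 / r^4; the factor 1/(j+1) of the walk, averaged over the binomially distributed number
  \<open>j\<close> of flips, gives a multiple of 1/(k+1); the sector volume gives 1/r^(N-1). In the
  series, t^(k+1)/(k+1)! times k+1 sums to t exp(t), and exp(t) cancels against the factor in front
  of \<open>W\<close>. The obstacle is that a flip controls only increments over
  \<open>2 *\<^sub>R a\<close>, with \<open>a\<close> near a fixed nonzero \<open>a0\<close>. A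
  short increment is written as the difference of two such long ones, which is why \<open>a\<close>
  must be allowed to vary and all constants must be uniform in it. Increments are used in place of
  gradients until the very end, since the pieces of the split kernel are merely continuous.\<close>

primrec srw :: "nat \<Rightarrow> int \<Rightarrow> real" where
  "srw 0 m = (if m = 0 then 1 else 0)"
| "srw (Suc n) m = (srw n (m - 1) + srw n (m + 1)) / 2"

lemma srw_nonneg: "srw n m \<ge> 0"
  by (induction n arbitrary: m) auto

lemma srw_eq_0: "\<bar>m\<bar> > int n \<Longrightarrow> srw n m = 0"
  by (induction n arbitrary: m) auto

lemma srw_uminus: "srw n (- m) = srw n m"
proof (induction n arbitrary: m)
  case (Suc n)
  have "srw n (- m - 1) = srw n (m + 1)" "srw n (- m + 1) = srw n (m - 1)"
    using Suc[of "m + 1"] Suc[of "m - 1"] by simp_all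
  then show ?case by simp
qed simp

text \<open>This is the ratio of neighbouring binomial coefficients, as \<open>srw n m\<close> is (n
  choose (n+m)/2) / 2^n on its parity class. Cleared of denominators it holds for every integer
  \<open>m\<close>. In the induction step both sides reduce to (n+1) *
  \<open>srw n m\<close>.\<close>

lemma srw_balance:
  "(real n + 1 - of_int m) * srw n (m - 1) = (real n + 1 + of_int m) * srw n (m + 1)"
proof (induction n arbitrary: m)
  case 0
  then show ?case by (cases "m = 1"; cases "m = -1") auto
next
  case (Suc n)
  have 1: "(real n + 2 - of_int m) * srw n (m - 2) = (real n + of_int m) * srw n m"
    using Suc[of "m - 1"] by (simp add: algebra_simps)
  have 2: "(real n - of_int m) * srw n m = (real n + 2 + of_int m) * srw n (m + 2)"
    using Suc[of "m + 1"] by (simp add: algebra_simps)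
  show ?case using 1 2 by (simp add: algebra_simps)
qed

text \<open>Discrete form of the Gaussian identity - p' = (x/t) p: a difference costs a factor
  \<open>m\<close> and gains a factor 1/(n+1).\<close>

lemma srw_diff:
  "srw n (m - 1) - srw n (m + 1) = 2 * of_int m / (real n + 1) * srw (Suc n) m"
  using srw_balance[of n m] by (simp add: field_simps)

text \<open>By \<open>srw_diff\<close> the difference has the sign of its midpoint
  \<open>m - 1\<close>. Steps of length 2 stay inside a parity class.\<close>

lemma srw_antimono_step: "m \<ge> 1 \<Longrightarrow> srw n m \<le> srw n (m - 2)"
proof -
  assume "m \<ge> 1"
  then have "0 \<le> 2 * of_int (m - 1) / (real n + 1) * srw (Suc n) (m - 1)"
    by (intro mult_nonneg_nonneg divide_nonneg_nonneg srw_nonneg) auto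
  then show ?thesis using srw_diff[of n "m - 1"] by (simp del: srw.simps)
qed

section \<open>Expectations under the random walk\<close>

definition walk_mean :: "nat \<Rightarrow> (int \<Rightarrow> real) \<Rightarrow> real" where
  "walk_mean n \<phi> = (\<Sum>m\<in>{- int n..int n}. srw n m * \<phi> m)"

lemma walk_mean_eq:
  assumes "finite A" "{- int n..int n} \<subseteq> A"
  shows "walk_mean n \<phi> = (\<Sum>m\<in>A. srw n m * \<phi> m)"
  unfolding walk_mean_def using assms
  by (intro sum.mono_neutral_left) (auto intro!: srw_eq_0)

lemma walk_mean_0 [simp]: "walk_mean 0 \<phi> = \<phi> 0"
  by (simp add: walk_mean_def)

lemma sum_int_shift:
  fixes f :: "int \<Rightarrow> 'b::comm_monoid_add"
  shows "(\<Sum>m\<in>{a..b}. f (m + c)) = (\<Sum>m\<in>{a + c..b + c}. f m)"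
  by (rule sum.reindex_bij_witness[of _ "\<lambda>m. m - c" "\<lambda>m. m + c"]) auto

lemma walk_mean_shift:
  "walk_mean n (\<lambda>m. \<phi> (m + c)) = (\<Sum>m\<in>{- int n + c..int n + c}. srw n (m - c) * \<phi> m)"
  unfolding walk_mean_def
  using sum_int_shift[of "\<lambda>m. srw n (m - c) * \<phi> m" c "- int n" "int n"] by simp

lemma walk_mean_shift':
  assumes "\<bar>c\<bar> \<le> 1"
  shows "walk_mean n (\<lambda>m. \<phi> (m + c)) = (\<Sum>m\<in>{- int (Suc n)..int (Suc n)}. srw n (m - c) * \<phi> m)"
  unfolding walk_mean_shift using assms
  by (intro sum.mono_neutral_left) (auto intro!: srw_eq_0)

lemma walk_mean_Suc:
  "walk_mean (Suc n) \<phi> = (walk_mean n (\<lambda>m. \<phi> (m + 1)) + walk_mean n (\<lambda>m. \<phi> (m - 1))) / 2"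
proof -
  have "walk_mean n (\<lambda>m. \<phi> (m - 1)) = (\<Sum>m\<in>{- int (Suc n)..int (Suc n)}. srw n (m + 1) * \<phi> m)"
    using walk_mean_shift'[of "-1" n \<phi>] by simp
  then show ?thesis
    unfolding walk_mean_shift'[of 1 n \<phi>, simplified] walk_mean_def[of "Suc n"]
    by (simp add: sum.distrib sum_divide_distrib add_divide_distrib distrib_right)
qed

text \<open>Summation by parts puts the difference on the walk, so nothing is asked of
  \<open>\<phi>\<close>; it will be a merely continuous density evaluated along a line.\<close>

lemma walk_mean_diff:
  "walk_mean n (\<lambda>m. \<phi> (m + 1)) - walk_mean n (\<lambda>m. \<phi> (m - 1))
    = 2 / (real n + 1) * walk_mean (Suc n) (\<lambda>m. of_int m * \<phi> m)"
proof -
  have "walk_mean n (\<lambda>m. \<phi> (m - 1)) = (\<Sum>m\<in>{- int (Suc n)..int (Suc n)}. srw n (m + 1) * \<phi> m)"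
    using walk_mean_shift'[of "-1" n \<phi>] by simp
  then have "walk_mean n (\<lambda>m. \<phi> (m + 1)) - walk_mean n (\<lambda>m. \<phi> (m - 1))
    = (\<Sum>m\<in>{- int (Suc n)..int (Suc n)}. (srw n (m - 1) - srw n (m + 1)) * \<phi> m)"
    unfolding walk_mean_shift'[of 1 n \<phi>, simplified]
    by (simp add: sum_subtractf left_diff_distrib)
  also have "\<dots> = 2 / (real n + 1) * walk_mean (Suc n) (\<lambda>m. of_int m * \<phi> m)"
    unfolding srw_diff walk_mean_def sum_distrib_left by (intro sum.cong) (auto simp del: srw.simps)
  finally show ?thesis .
qed

lemma walk_mean_add: "walk_mean n (\<lambda>m. \<phi> m + \<psi> m) = walk_mean n \<phi> + walk_mean n \<psi>"
  by (simp add: walk_mean_def distrib_left sum.distrib)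

lemma walk_mean_cmult: "walk_mean n (\<lambda>m. c * \<phi> m) = c * walk_mean n \<phi>"
  by (simp add: walk_mean_def sum_distrib_left ac_simps)

lemma abs_walk_mean_le: "\<bar>walk_mean n \<phi>\<bar> \<le> walk_mean n (\<lambda>m. \<bar>\<phi> m\<bar>)"
  unfolding walk_mean_def
  by (rule order.trans[OF sum_abs]) (simp add: abs_mult srw_nonneg)

lemma walk_mean_1 [simp]: "walk_mean n (\<lambda>m. c) = c"
  by (induction n) (auto simp: walk_mean_Suc)

lemma walk_mean_moments:
  "walk_mean n (\<lambda>m. of_int m ^ 2) = real n"
  "walk_mean n (\<lambda>m. of_int m ^ 4) = 3 * real n ^ 2 - 2 * real n"
proof -
  show 2: "walk_mean n (\<lambda>m. of_int m ^ 2) = real n" for n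
  proof (induction n)
    case (Suc n)
    have "walk_mean n (\<lambda>m. of_int (m + 1) ^ 2) + walk_mean n (\<lambda>m. of_int (m - 1) ^ 2)
        = walk_mean n (\<lambda>m. 2 * of_int m ^ 2 + 2)"
      unfolding walk_mean_add[symmetric] by (simp add: power2_eq_square algebra_simps)
    then show ?case
      using Suc by (simp add: walk_mean_Suc walk_mean_add walk_mean_cmult)
  qed simp
  show "walk_mean n (\<lambda>m. of_int m ^ 4) = 3 * real n ^ 2 - 2 * real n"
  proof (induction n)
    case (Suc n)
    have "walk_mean n (\<lambda>m. of_int (m + 1) ^ 4) + walk_mean n (\<lambda>m. of_int (m - 1) ^ 4)
        = walk_mean n (\<lambda>m. 2 * of_int m ^ 4 + (12 * of_int m ^ 2 + 2))"
      unfolding walk_mean_add[symmetric] by (simp add: power2_eq_square power4_eq_xxxx algebra_simps)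
    then have e: "walk_mean n (\<lambda>m. of_int (m + 1) ^ 4) + walk_mean n (\<lambda>m. of_int (m - 1) ^ 4)
        = 2 * (3 * real n ^ 2 - 2 * real n) + (12 * real n + 2)"
      by (simp only: walk_mean_add walk_mean_cmult walk_mean_1 2 Suc)
    show ?case
      unfolding walk_mean_Suc e by (simp add: power2_eq_square field_simps)
  qed simp
qed

text \<open>The walk is unimodal on each parity class, so \<open>srw n m\<close> is at most the average of the
  values at the roughly \<open>m / 4\<close> points \<open>m, m - 2, \<dots>\<close> above \<open>m / 2\<close>.\<close>

lemma srw_tail_nonneg:
  assumes "m \<ge> 0"
  shows "srw n m * (of_int m / 4) * (of_int m / 2) ^ p \<le> walk_mean n (\<lambda>l. \<bar>of_int l\<bar> ^ p)"
proof -
  \<comment> \<open>Indices up to \<open>m div 4\<close> keep the points above m/2, and the count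
    \<open>m div 4\<close> + 1 is at least m/4 in spite of the rounding.\<close>
  define A where "A = (\<lambda>i. m - 2 * int i) ` {..nat (m div 4)}"
  have inj: "inj_on (\<lambda>i. m - 2 * int i) {..nat (m div 4)}"
    by (auto simp: inj_on_def)
  have cardA: "card A = nat (m div 4) + 1"
    unfolding A_def by (simp add: card_image[OF inj])
  have "m \<le> 4 * (m div 4 + 1)" by presburger
  then have "real_of_int m \<le> 4 * (of_int (m div 4) + 1)"
    by (metis (mono_tags, opaque_lifting) of_int_1 of_int_add of_int_le_iff of_int_mult of_int_numeral)
  then have c: "of_int m / 4 \<le> real (card A)"
    using assms cardA by (simp add: of_nat_nat pos_imp_zdiv_nonneg_iff)
  have mono: "2 * int i \<le> m \<Longrightarrow> srw n m \<le> srw n (m - 2 * int i)" for i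
  proof (induction i)
    case (Suc i)
    then show ?case
      using srw_antimono_step[of "m - 2 * int i" n] by (auto simp: algebra_simps)
  qed simp
  have l: "srw n m \<le> srw n l \<and> m \<le> 2 * l \<and> l \<le> m" if "l \<in> A" for l
  proof -
    obtain i where i: "l = m - 2 * int i" "i \<le> nat (m div 4)"
      using \<open>l \<in> A\<close> unfolding A_def by blast
    then have "4 * int i \<le> m" using assms by linarith
    then show ?thesis using mono[of i] i assms by auto
  qed
  have "srw n m * (of_int m / 4) * (of_int m / 2) ^ p \<le> srw n m * real (card A) * (of_int m / 2) ^ p"
    using c assms srw_nonneg by (intro mult_right_mono mult_left_mono) auto
  also have "\<dots> = (\<Sum>l\<in>A. srw n m * (of_int m / 2) ^ p)" by simp
  also have "\<dots> \<le> (\<Sum>l\<in>A. srw n l * \<bar>of_int l\<bar> ^ p)"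
  proof (intro sum_mono mult_mono power_mono)
    fix x assume "x \<in> A"
    then have "m \<le> 2 * x" using l by blast
    then have "real_of_int m \<le> of_int (2 * x)" using of_int_le_iff by blast
    then show "real_of_int m / 2 \<le> \<bar>of_int x\<bar>" by simp
  qed (use l assms srw_nonneg in auto)
  \<comment> \<open>\<open>A\<close> may reach beyond \<open>n\<close>; the union contains both
    ranges, and \<open>srw\<close> vanishes on the excess.\<close>
  also have "\<dots> \<le> (\<Sum>l\<in>A \<union> {- int n..int n}. srw n l * \<bar>of_int l\<bar> ^ p)"
    by (intro sum_mono2) (auto simp: A_def srw_nonneg)
  also have "\<dots> = walk_mean n (\<lambda>l. \<bar>of_int l\<bar> ^ p)"
    by (rule walk_mean_eq[symmetric]) (auto simp: A_def)
  finally show ?thesis .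
qed

lemma srw_tail:
  "srw n m * (\<bar>of_int m\<bar> / 4) * (\<bar>of_int m\<bar> / 2) ^ p \<le> walk_mean n (\<lambda>l. \<bar>of_int l\<bar> ^ p)"
  using srw_tail_nonneg[of "\<bar>m\<bar>" n p] srw_uminus[of n m] by (cases "m \<ge> 0") auto

lemma srw_abs_le: "\<bar>of_int m\<bar> * srw n m \<le> 4"
  using srw_tail[of n m 0] by (simp add: field_simps)

text \<open>The constant is 4 * 2^4 from the tail bound with exponent 4, times the 3 of the fourth
  moment.\<close>

lemma srw_abs5_le: "\<bar>of_int m\<bar> ^ 5 * srw n m \<le> 192 * real n ^ 2"
proof -
  have "\<bar>of_int m\<bar> ^ 5 * srw n m = 64 * (srw n m * (\<bar>of_int m\<bar> / 4) * (\<bar>of_int m\<bar> / 2) ^ 4)"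
    by (simp add: power_divide eval_nat_numeral)
  also have "\<dots> \<le> 64 * walk_mean n (\<lambda>l. \<bar>of_int l\<bar> ^ 4)"
    by (intro mult_left_mono srw_tail) auto
  also have "\<dots> \<le> 192 * real n ^ 2"
    by (simp add: walk_mean_moments)
  finally show ?thesis .
qed

subsection \<open>Continuous functions of compact support and their convolutions\<close>

text \<open>Continuity is all that is retained from smoothness, because the tent function split off
  the kernel is not differentiable. The class is stable under convolution and settles
  integrability.\<close>

definition ccs :: "('a::euclidean_space \<Rightarrow> real) \<Rightarrow> bool" where
  "ccs f \<longleftrightarrow> continuous_on UNIV f \<and> (\<exists>r. \<forall>x. norm x > r \<longrightarrow> f x = 0)"

lemma ccsI: "continuous_on UNIV f \<Longrightarrow> (\<And>x. norm x > r \<Longrightarrow> f x = 0) \<Longrightarrow> ccs f"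
  by (auto simp: ccs_def)

lemma ccs_continuous: "ccs f \<Longrightarrow> continuous_on UNIV f"
  by (simp add: ccs_def)

lemma ccs_measurable: "ccs f \<Longrightarrow> f \<in> borel_measurable borel"
  by (simp add: borel_measurable_continuous_onI ccs_continuous)

lemma ccs_support:
  assumes "ccs f"
  obtains r where "r > 0" "\<And>x. norm x > r \<Longrightarrow> f x = 0"
proof -
  obtain r where "\<forall>x. norm x > r \<longrightarrow> f x = 0"
    using assms unfolding ccs_def by blast
  then show ?thesis by (intro that[of "max r 1"]) auto
qed

lemma ccs_mult:
  assumes "continuous_on UNIV p" "ccs f"
  shows "ccs (\<lambda>x. p x * f x)"
proof -
  obtain r where "r > 0" "\<And>x. norm x > r \<Longrightarrow> f x = 0"
    using ccs_support[OF assms(2)] by blast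
  then show ?thesis
    by (auto intro!: ccsI[of _ r] continuous_on_mult assms(1) ccs_continuous[OF assms(2)])
qed

lemma ccs_cmult: "ccs f \<Longrightarrow> ccs (\<lambda>x. c * f x)"
  by (rule ccs_mult) auto

lemma ccs_add:
  assumes "ccs f" "ccs g"
  shows "ccs (\<lambda>x. f x + g x)"
proof -
  obtain r where r: "r > 0" "\<And>x. norm x > r \<Longrightarrow> f x = 0"
    using ccs_support[OF assms(1)] by blast
  obtain s where "s > 0" "\<And>x. norm x > s \<Longrightarrow> g x = 0"
    using ccs_support[OF assms(2)] by blast
  with r show ?thesis
    by (auto intro!: ccsI[of _ "max r s"] continuous_on_add ccs_continuous[OF assms(1)]
          ccs_continuous[OF assms(2)])
qed

lemma ccs_diff: "ccs f \<Longrightarrow> ccs g \<Longrightarrow> ccs (\<lambda>x. f x - g x)"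
  using ccs_add[of f "\<lambda>x. - 1 * g x"] ccs_cmult[of g "- 1"] by simp

lemma ccs_0 [simp]: "ccs (\<lambda>x. 0)"
  by (simp add: ccs_def)

lemma ccs_sum: "(\<And>i. i \<in> A \<Longrightarrow> ccs (f i)) \<Longrightarrow> ccs (\<lambda>x. \<Sum>i\<in>A. f i x)"
  by (induction A rule: infinite_finite_induct) (auto intro: ccs_add)

lemma ccs_shift:
  assumes "ccs f"
  shows "ccs (\<lambda>x. f (x + a))"
proof -
  obtain r where r: "r > 0" "\<And>x. norm x > r \<Longrightarrow> f x = 0"
    using ccs_support[OF assms] by blast
  show ?thesis
  proof (rule ccsI[of _ "r + norm a"])
    show "continuous_on UNIV (\<lambda>x. f (x + a))"
      by (rule continuous_on_compose2[OF ccs_continuous[OF assms]]) (auto intro!: continuous_intros)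
    show "f (x + a) = 0" if "norm x > r + norm a" for x
      using that norm_triangle_ineq4[of "x + a" a] by (intro r) simp
  qed
qed

lemma ccs_minus:
  assumes "ccs f"
  shows "ccs (\<lambda>x. f (- x))"
proof -
  obtain r where r: "r > 0" "\<And>x. norm x > r \<Longrightarrow> f x = 0"
    using ccs_support[OF assms] by blast
  show ?thesis
    by (rule ccsI[of _ r])
       (auto intro!: continuous_on_compose2[OF ccs_continuous[OF assms]] continuous_intros r)
qed

lemma ccs_flip:
  assumes "ccs f"
  shows "ccs (\<lambda>y. f (x - y))"
  using ccs_minus[OF ccs_shift[OF assms, of x]] by (simp add: add.commute)

lemma ccs_bounded:
  assumes "ccs f"
  obtains B where "B > 0" "\<And>x. \<bar>f x\<bar> \<le> B"
proof -
  obtain r where r: "r > 0" "\<And>x. norm x > r \<Longrightarrow> f x = 0"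
    using ccs_support[OF assms] by blast
  have "compact (f ` cball 0 r)"
    by (intro compact_continuous_image continuous_on_subset[OF ccs_continuous[OF assms]]) auto
  then obtain B where B: "B > 0" "\<And>y. y \<in> f ` cball 0 r \<Longrightarrow> norm y \<le> B"
    using compact_imp_bounded bounded_pos by metis
  have "\<bar>f x\<bar> \<le> B" for x
    using B(2)[of "f x"] B(1) r(2)[of x] by (cases "norm x > r") auto
  then show ?thesis using B(1) that by blast
qed

lemma integrable_bounded_support:
  fixes f :: "'a::euclidean_space \<Rightarrow> real"
  assumes "f \<in> borel_measurable borel" "\<And>x. \<bar>f x\<bar> \<le> B" "\<And>x. norm x > r \<Longrightarrow> f x = 0"
  shows "integrable lborel f"
  by (rule integrableI_bounded_set[of "cball 0 r" _ _ B])
     (use assms emeasure_bounded_finite[of "cball 0 r :: 'a set"] in \<open>auto simp: not_le\<close>)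

lemma ccs_integrable:
  assumes "ccs f"
  shows "integrable lborel f"
proof -
  obtain r where r: "r > 0" "\<And>x. norm x > r \<Longrightarrow> f x = 0"
    using ccs_support[OF assms] by blast
  obtain B where "B > 0" "\<And>x. \<bar>f x\<bar> \<le> B"
    using ccs_bounded[OF assms] by blast
  with r show ?thesis by (intro integrable_bounded_support ccs_measurable assms)
qed

section \<open>Translation, point reflection and Fubini for the Lebesgue integral\<close>

lemma lborel_integral_shift:
  fixes f :: "'a::euclidean_space \<Rightarrow> real"
  assumes "f \<in> borel_measurable borel"
  shows "(LINT x|lborel. f (x + a)) = (LINT x|lborel. f x)"
proof -
  have "(LINT x|lborel. f x) = (LINT x|distr lborel borel ((+) a). f x)"
    by (simp add: lborel_distr_plus)
  also have "\<dots> = (LINT x|lborel. f (x + a))"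
    by (subst integral_distr) (use assms in \<open>auto simp: add.commute\<close>)
  finally show ?thesis by simp
qed

lemma lborel_integral_flip:
  fixes f :: "'a::euclidean_space \<Rightarrow> real"
  assumes "f \<in> borel_measurable borel"
  shows "(LINT x|lborel. f (a - x)) = (LINT x|lborel. f x)"
proof -
  have "distr lborel borel (\<lambda>x. a + (- 1) *\<^sub>R x) = (lborel :: 'a measure)"
    using lborel_affine[of "- 1" a] by (simp add: density_1)
  then have "(LINT x|lborel. f x) = (LINT x|distr lborel borel (\<lambda>x. a + (- 1) *\<^sub>R x). f x)"
    by simp
  also have "\<dots> = (LINT x|lborel. f (a - x))"
    by (subst integral_distr) (use assms in auto)
  finally show ?thesis by simp
qed

lemma lborel_Fubini_bounded:
  fixes F :: "'a::euclidean_space \<Rightarrow> 'b::euclidean_space \<Rightarrow> real"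
  assumes "case_prod F \<in> borel_measurable borel" "\<And>x y. \<bar>F x y\<bar> \<le> B"
    "\<And>x y. norm x > r \<or> norm y > r \<Longrightarrow> F x y = 0"
  shows "(LINT x|lborel. LINT y|lborel. F x y) = (LINT y|lborel. LINT x|lborel. F x y)"
    and "integrable lborel (\<lambda>x. LINT y|lborel. F x y)"
proof -
  have "F x y = 0" if "norm (x, y) > 2 * r" for x y
  proof (rule assms(3), rule ccontr)
    assume "\<not> (r < norm x \<or> r < norm y)"
    then show False using norm_Pair_le[of x y] that by auto
  qed
  then have "integrable lborel (case_prod F)"
    by (intro integrable_bounded_support[of _ B "2 * r"] assms(1)) (auto simp: assms(2))
  then have i: "integrable (lborel \<Otimes>\<^sub>M lborel) (case_prod F)"
    by (simp add: lborel_prod)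
  show "(LINT x|lborel. LINT y|lborel. F x y) = (LINT y|lborel. LINT x|lborel. F x y)"
    using lborel_pair.Fubini_integral[OF i] by simp
  show "integrable lborel (\<lambda>x. LINT y|lborel. F x y)"
    using lborel_pair.integrable_fst[OF i] by simp
qed

section \<open>Convolution and its moments\<close>

definition conv :: "('a::euclidean_space \<Rightarrow> real) \<Rightarrow> ('a \<Rightarrow> real) \<Rightarrow> 'a \<Rightarrow> real" where
  "conv f g x = (LINT y|lborel. f (x - y) * g y)"

lemma conv_integrable:
  assumes "ccs f" "continuous_on UNIV g"
  shows "integrable lborel (\<lambda>y. f (x - y) * g y)"
  using ccs_integrable[OF ccs_mult[OF assms(2) ccs_flip[OF assms(1)]]]
  by (simp add: mult.commute)

lemma conv_alt:
  assumes "ccs f" "continuous_on UNIV g"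
  shows "conv f g x = (LINT z|lborel. f z * g (x - z))"
proof -
  have m: "g \<in> borel_measurable borel" using assms(2) by (rule borel_measurable_continuous_onI)
  have [measurable]: "f \<in> borel_measurable borel" by (rule ccs_measurable[OF assms(1)])
  show ?thesis
    using lborel_integral_flip[of "\<lambda>y. f (x - y) * g y" x] m by (simp add: conv_def)
qed

lemma conv_continuous:
  assumes "ccs f" "continuous_on UNIV g" "\<And>x. \<bar>g x\<bar> \<le> B"
  shows "continuous_on UNIV (conv f g)"
proof (rule continuous_at_imp_continuous_on, rule ballI)
  fix x :: 'a
  have [measurable]: "f \<in> borel_measurable borel" "g \<in> borel_measurable borel"
    using assms by (auto intro: ccs_measurable borel_measurable_continuous_onI)
  show "isCont (conv f g) x"
    unfolding continuous_at_sequentially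
  proof (intro allI impI)
    fix u :: "nat \<Rightarrow> 'a" assume u: "u \<longlonglongrightarrow> x"
    have "(\<lambda>n. LINT z|lborel. f z * g (u n - z)) \<longlonglongrightarrow> (LINT z|lborel. f z * g (x - z))"
    proof (rule integral_dominated_convergence[where w = "\<lambda>z. \<bar>f z\<bar> * B"])
      show "integrable lborel (\<lambda>z. \<bar>f z\<bar> * B)"
        using ccs_integrable[OF assms(1)] by auto
      have "(\<lambda>n. g (u n - z)) \<longlonglongrightarrow> g (x - z)" for z
        using assms(2) u by (intro isCont_tendsto_compose[of _ g] tendsto_intros)
          (auto simp: continuous_on_eq_continuous_at)
      then show "AE z in lborel. (\<lambda>n. f z * g (u n - z)) \<longlonglongrightarrow> f z * g (x - z)"
        by (auto intro!: tendsto_intros)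
    qed (auto simp: abs_mult intro!: mult_left_mono assms)
    then show "(conv f g \<circ> u) \<longlonglongrightarrow> conv f g x"
      by (simp add: conv_alt[OF assms(1,2)] o_def)
  qed
qed

lemma ccs_conv:
  assumes "ccs f" "ccs g"
  shows "ccs (conv f g)"
proof -
  obtain r where r: "r > 0" "\<And>x. norm x > r \<Longrightarrow> f x = 0"
    using ccs_support[OF assms(1)] by blast
  obtain s where s: "s > 0" "\<And>x. norm x > s \<Longrightarrow> g x = 0"
    using ccs_support[OF assms(2)] by blast
  obtain B where B: "B > 0" "\<And>x. \<bar>g x\<bar> \<le> B"
    using ccs_bounded[OF assms(2)] by blast
  show ?thesis
  proof (rule ccsI[of _ "r + s"])
    show "continuous_on UNIV (conv f g)"
      by (rule conv_continuous[OF assms(1) ccs_continuous[OF assms(2)] B(2)])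
    fix x :: 'a assume x: "norm x > r + s"
    have "f (x - y) * g y = 0" for y
    proof (cases "norm y > s")
      case False
      then have "norm (x - y) > r" using x norm_triangle_sub[of x y] by linarith
      then show ?thesis using r by simp
    qed (use s in simp)
    then have "(\<lambda>y. f (x - y) * g y) = (\<lambda>y. 0)" by (rule ext)
    then show "conv f g x = 0" by (simp only: conv_def integral_zero)
  qed
qed

lemma conv_nonneg: "(\<And>x. f x \<ge> 0) \<Longrightarrow> (\<And>x. g x \<ge> 0) \<Longrightarrow> conv f g x \<ge> 0"
  unfolding conv_def by (intro integral_nonneg_AE) auto

lemma conv_add_left:
  assumes "ccs f1" "ccs f2" "continuous_on UNIV g"
  shows "conv (\<lambda>x. f1 x + f2 x) g x = conv f1 g x + conv f2 g x"
  unfolding conv_def distrib_right by (intro Bochner_Integration.integral_add conv_integrable assms)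

lemma conv_cmult_left: "conv (\<lambda>x. c * f x) g x = c * conv f g x"
  unfolding conv_def by (simp add: mult.assoc)

lemma conv_cmult_right: "conv f (\<lambda>x. c * g x) x = c * conv f g x"
  unfolding conv_def by (simp add: mult.left_commute)

lemma conv_add_right:
  assumes "ccs f" "continuous_on UNIV g1" "continuous_on UNIV g2"
  shows "conv f (\<lambda>x. g1 x + g2 x) x = conv f g1 x + conv f g2 x"
  unfolding conv_def distrib_left by (intro Bochner_Integration.integral_add conv_integrable assms)

lemma conv_sum_right:
  assumes "ccs f" "finite A" "\<And>i. i \<in> A \<Longrightarrow> continuous_on UNIV (g i)"
  shows "conv f (\<lambda>x. \<Sum>i\<in>A. g i x) x = (\<Sum>i\<in>A. conv f (g i) x)"
  unfolding conv_def sum_distrib_left by (intro Bochner_Integration.integral_sum conv_integrable assms)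

lemma conv_shift_left: "conv (\<lambda>x. f (x + a)) g x = conv f g (x + a)"
  unfolding conv_def by (simp add: algebra_simps)

lemma conv_shift_right:
  assumes "ccs f" "continuous_on UNIV g"
  shows "conv f (\<lambda>x. g (x + a)) x = conv f g (x + a)"
proof -
  have "continuous_on UNIV (\<lambda>x. g (x + a))"
    by (rule continuous_on_compose2[OF assms(2)]) (auto intro!: continuous_intros)
  then show ?thesis
    by (simp add: conv_alt assms algebra_simps)
qed

text \<open>Taking \<open>\<psi>\<close> constant gives the mass of a convolution, taking it a power
  of the norm gives the moments.\<close>

lemma integral_conv:
  assumes "ccs f" "ccs g" "continuous_on UNIV \<psi>"
  shows "(LINT x|lborel. \<psi> x * conv f g x) = (LINT y|lborel. g y * (LINT z|lborel. f z * \<psi> (z + y)))"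
proof -
  obtain r where r: "r > 0" "\<And>x. norm x > r \<Longrightarrow> f x = 0"
    using ccs_support[OF assms(1)] by blast
  obtain s where s: "s > 0" "\<And>x. norm x > s \<Longrightarrow> g x = 0"
    using ccs_support[OF assms(2)] by blast
  have [measurable]: "f \<in> borel_measurable borel" "\<psi> \<in> borel_measurable borel"
    using assms by (auto intro: ccs_measurable borel_measurable_continuous_onI)
  let ?F = "\<lambda>x y. \<psi> x * (f (x - y) * g y)"
  have z: "?F x y = 0" if "norm x > r + s \<or> norm y > r + s" for x y
  proof (cases "norm y > s")
    case False
    then have "norm (x - y) > r" using that r(1) norm_triangle_sub[of x y] by linarith
    then show ?thesis using r by simp
  qed (use s in simp)
  have "ccs (case_prod ?F)"
  proof (rule ccsI[of _ "2 * (r + s)"])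
    show "continuous_on UNIV (case_prod ?F)"
      unfolding case_prod_beta
      by (intro continuous_intros continuous_on_compose2[OF assms(3)]
            continuous_on_compose2[OF ccs_continuous[OF assms(1)]]
            continuous_on_compose2[OF ccs_continuous[OF assms(2)]]) auto
    fix p :: "'a \<times> 'a" assume "norm p > 2 * (r + s)"
    then have "norm (fst p) > r + s \<or> norm (snd p) > r + s"
      using norm_Pair_le[of "fst p" "snd p"] by auto
    then show "case_prod ?F p = 0" using z by (simp add: case_prod_beta)
  qed
  then obtain B where B: "\<And>p. \<bar>case_prod ?F p\<bar> \<le> B" and m: "case_prod ?F \<in> borel_measurable borel"
    using ccs_bounded ccs_measurable by blast
  have "(LINT x|lborel. \<psi> x * conv f g x) = (LINT x|lborel. LINT y|lborel. ?F x y)"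
    by (simp add: conv_def)
  also have "\<dots> = (LINT y|lborel. LINT x|lborel. ?F x y)"
    by (rule lborel_Fubini_bounded(1)[OF m _ z]) (use B in auto)
  also have "\<dots> = (LINT y|lborel. g y * (LINT x|lborel. f (x - y) * \<psi> x))"
    by (simp add: mult_ac flip: integral_mult_right_zero)
  also have "\<dots> = (LINT y|lborel. g y * (LINT z|lborel. f z * \<psi> (z + y)))"
    using lborel_integral_shift[of "\<lambda>x. f (x - y) * \<psi> x" y for y] by simp
  finally show ?thesis .
qed

lemma integral_conv_1:
  assumes "ccs f" "ccs g"
  shows "(LINT x|lborel. conv f g x) = (LINT x|lborel. f x) * (LINT x|lborel. g x)"
  using integral_conv[OF assms, of "\<lambda>_. 1"] by (simp add: mult.commute)

text \<open>Averaging over \<open>z\<close> and \<open>-z\<close> removes the odd terms of the binomial expansion.\<close>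

lemma integral_even_power_le:
  fixes f :: "'a::euclidean_space \<Rightarrow> real"
  assumes "ccs f" "\<And>x. f x \<ge> 0" "\<And>x. f (- x) = f x" "\<And>x. norm x > r \<Longrightarrow> f x = 0"
  shows "(LINT z|lborel. f z * norm (z + y) ^ 2) \<le> (LINT z|lborel. f z) * (norm y ^ 2 + r ^ 2)"
    and "(LINT z|lborel. f z * norm (z + y) ^ 4)
      \<le> (LINT z|lborel. f z) * (norm y ^ 4 + 6 * r ^ 2 * norm y ^ 2 + r ^ 4)"
proof -
  have *: "(LINT z|lborel. f z * norm (z + y) ^ p) \<le> (LINT z|lborel. f z) * c"
    if le: "\<And>z. norm z \<le> r \<Longrightarrow> norm (z + y) ^ p + norm (- z + y) ^ p \<le> 2 * c" for p c
  proof -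
    have ccs: "ccs (\<lambda>z. norm (e z + y) ^ p * f z)" if "continuous_on UNIV e" for e
      by (intro ccs_mult continuous_intros that assms)
    have i1: "integrable lborel (\<lambda>z. norm (z + y) ^ p * f z)"
      by (intro ccs_integrable ccs continuous_intros)
    have i2: "integrable lborel (\<lambda>z. norm (- z + y) ^ p * f z)"
      by (intro ccs_integrable ccs continuous_intros)
    have "(LINT z|lborel. norm (- z + y) ^ p * f z) = (LINT z|lborel. norm (z + y) ^ p * f z)"
      using lborel_integral_flip[OF ccs_measurable[OF ccs[of "\<lambda>z. z"]], of 0] assms(3) by simp
    then have "2 * (LINT z|lborel. norm (z + y) ^ p * f z)
      = (LINT z|lborel. norm (z + y) ^ p * f z + norm (- z + y) ^ p * f z)"
      by (subst Bochner_Integration.integral_add) (use i1 i2 in auto)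
    also have "\<dots> \<le> (LINT z|lborel. 2 * c * f z)"
    proof (rule integral_mono)
      show "norm (z + y) ^ p * f z + norm (- z + y) ^ p * f z \<le> 2 * c * f z" for z
        using mult_right_mono[OF le[of z] assms(2)[of z]] assms(4)[of z]
        by (cases "norm z > r") (auto simp: distrib_right)
    qed (use i1 i2 ccs_integrable[OF assms(1)] in auto)
    finally show ?thesis by (simp add: mult.commute)
  qed
  have sq: "norm (z + y) ^ 2 = norm z ^ 2 + 2 * (z \<bullet> y) + norm y ^ 2"
    "norm (- z + y) ^ 2 = norm z ^ 2 - 2 * (z \<bullet> y) + norm y ^ 2" for z
    by (simp_all add: power2_norm_eq_inner inner_simps inner_commute)
  show "(LINT z|lborel. f z * norm (z + y) ^ 2) \<le> (LINT z|lborel. f z) * (norm y ^ 2 + r ^ 2)"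
  proof (rule *)
    fix z :: 'a assume "norm z \<le> r"
    then have "norm z ^ 2 \<le> r ^ 2" by (simp add: power_mono)
    then show "norm (z + y) ^ 2 + norm (- z + y) ^ 2 \<le> 2 * (norm y ^ 2 + r ^ 2)"
      unfolding sq by simp
  qed
  show "(LINT z|lborel. f z * norm (z + y) ^ 4)
      \<le> (LINT z|lborel. f z) * (norm y ^ 4 + 6 * r ^ 2 * norm y ^ 2 + r ^ 4)"
  proof (rule *)
    fix z :: 'a assume z: "norm z \<le> r"
    have e: "t ^ 4 = (t ^ 2) ^ 2" for t :: real by simp
    \<comment> \<open>Cauchy-Schwarz merges the mixed terms with coefficients 4 and 8 into 12, twice
      the constant 6 of the claim.\<close>
    have "(z \<bullet> y) ^ 2 \<le> norm z ^ 2 * norm y ^ 2"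
      using Cauchy_Schwarz_ineq2[of z y] by (metis abs_le_square_iff abs_mult abs_norm_cancel power_mult_distrib)
    moreover have "norm z ^ 2 \<le> r ^ 2" "norm z ^ 4 \<le> r ^ 4" "norm z ^ 2 * norm y ^ 2 \<le> r ^ 2 * norm y ^ 2"
      using z by (auto intro!: power_mono mult_right_mono)
    moreover have "norm (z + y) ^ 4 + norm (- z + y) ^ 4
        = 2 * norm z ^ 4 + 2 * norm y ^ 4 + 4 * (norm z ^ 2 * norm y ^ 2) + 8 * (z \<bullet> y) ^ 2"
      unfolding e sq by (simp add: power2_eq_square algebra_simps)
    ultimately have "norm (z + y) ^ 4 + norm (- z + y) ^ 4 \<le> 2 * (norm y ^ 4 + 6 * (r ^ 2 * norm y ^ 2) + r ^ 4)"
      by argo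
    then show "norm (z + y) ^ 4 + norm (- z + y) ^ 4 \<le> 2 * (norm y ^ 4 + 6 * r ^ 2 * norm y ^ 2 + r ^ 4)"
      by (simp only: mult.assoc)
  qed
qed

text \<open>Adding an independent symmetric step: the second moment grows by a constant per step and
  the fourth by a multiple of the second. Only the added factor \<open>f\<close> has to be
  even.\<close>

lemma conv_moment_le:
  fixes f g :: "'a::euclidean_space \<Rightarrow> real"
  assumes "ccs f" "\<And>x. f x \<ge> 0" "\<And>x. f (- x) = f x" "\<And>x. norm x > r \<Longrightarrow> f x = 0"
    and "ccs g" "\<And>x. g x \<ge> 0"
  shows "(LINT x|lborel. norm x ^ 2 * conv f g x)
      \<le> (LINT x|lborel. f x) * ((LINT x|lborel. norm x ^ 2 * g x) + r ^ 2 * (LINT x|lborel. g x))"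
    and "(LINT x|lborel. norm x ^ 4 * conv f g x)
      \<le> (LINT x|lborel. f x) * ((LINT x|lborel. norm x ^ 4 * g x)
           + 6 * r ^ 2 * (LINT x|lborel. norm x ^ 2 * g x) + r ^ 4 * (LINT x|lborel. g x))"
proof -
  have *: "(LINT x|lborel. norm x ^ p * conv f g x) \<le> (LINT y|lborel. g y * c y)"
    if le: "\<And>y. (LINT z|lborel. f z * norm (z + y) ^ p) \<le> c y" and c: "continuous_on UNIV c"
    for p and c :: "'a \<Rightarrow> real"
  proof -
    have cont: "continuous_on UNIV (\<lambda>x::'a. norm x ^ p)" by (intro continuous_intros)
    have ic: "integrable lborel (\<lambda>y. g y * c y)"
      using ccs_integrable[OF ccs_mult[OF c assms(5)]] by (simp add: mult.commute)
    have i: "0 \<le> (LINT z|lborel. f z * norm (z + y) ^ p)" for y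
      using assms by (intro integral_nonneg_AE) auto
    show ?thesis
      unfolding integral_conv[OF assms(1,5) cont]
      by (rule integral_mono'[OF ic]) (use le i assms in \<open>auto intro!: mult_left_mono mult_nonneg_nonneg order.trans[OF i le]\<close>)
  qed
  let ?m = "\<lambda>p. LINT x|lborel. norm x ^ p * g x"
  have m: "integrable lborel (\<lambda>y. norm y ^ p * g y)" for p
    by (intro ccs_integrable ccs_mult continuous_intros assms)
  note ig = ccs_integrable[OF assms(5)]
  have "(LINT x|lborel. norm x ^ 2 * conv f g x)
      \<le> (LINT y|lborel. g y * ((LINT z|lborel. f z) * (norm y ^ 2 + r ^ 2)))"
    by (intro * integral_even_power_le assms continuous_intros)
  also have "\<dots> = (LINT y|lborel. (LINT z|lborel. f z) * (norm y ^ 2 * g y + r ^ 2 * g y))"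
    by (simp add: algebra_simps)
  also have "\<dots> = (LINT x|lborel. f x) * (?m 2 + r ^ 2 * (LINT x|lborel. g x))"
    using m ig by simp
  finally show "(LINT x|lborel. norm x ^ 2 * conv f g x)
      \<le> (LINT x|lborel. f x) * (?m 2 + r ^ 2 * (LINT x|lborel. g x))" .
  have "(LINT x|lborel. norm x ^ 4 * conv f g x)
      \<le> (LINT y|lborel. g y * ((LINT z|lborel. f z) * (norm y ^ 4 + 6 * r ^ 2 * norm y ^ 2 + r ^ 4)))"
    by (intro * integral_even_power_le assms continuous_intros)
  also have "\<dots> = (LINT y|lborel. (LINT z|lborel. f z) *
      (norm y ^ 4 * g y + 6 * r ^ 2 * (norm y ^ 2 * g y) + r ^ 4 * g y))"
    by (simp add: algebra_simps)
  also have "\<dots> = (LINT x|lborel. f x) * (?m 4 + 6 * r ^ 2 * ?m 2 + r ^ 4 * (LINT x|lborel. g x))"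
    using m ig by simp
  finally show "(LINT x|lborel. norm x ^ 4 * conv f g x)
      \<le> (LINT x|lborel. f x) * (?m 4 + 6 * r ^ 2 * ?m 2 + r ^ 4 * (LINT x|lborel. g x))" .
qed

subsection \<open>Splitting a symmetric coin flip off the kernel\<close>

text \<open>The indexing starts at \<open>J\<close> because the empty convolution, the Dirac
  measure, is not a function.\<close>

primrec conv_power :: "('a::euclidean_space \<Rightarrow> real) \<Rightarrow> nat \<Rightarrow> 'a \<Rightarrow> real" where
  "conv_power J 0 = J"
| "conv_power J (Suc k) = conv J (conv_power J k)"

lemma ccs_conv_power: "ccs J \<Longrightarrow> ccs (conv_power J k)"
  by (induction k) (auto intro: ccs_conv)

lemma conv_power_nonneg: "(\<And>x. J x \<ge> 0) \<Longrightarrow> conv_power J k x \<ge> 0"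
  by (induction k arbitrary: x) (auto intro: conv_nonneg)

lemma integral_conv_power:
  assumes "ccs J" "(LINT x|lborel. J x) = 1"
  shows "(LINT x|lborel. conv_power J k x) = 1"
  by (induction k) (auto simp: assms integral_conv_1 ccs_conv_power)

lemma integrable_indicator_ccs:
  fixes f :: "'a::euclidean_space \<Rightarrow> real"
  assumes "ccs f" "S \<in> sets borel"
  shows "integrable lborel (\<lambda>x. indicator S x * f x)"
  using integrable_real_mult_indicator[OF _ ccs_integrable[OF assms(1)], of S] assms(2)
  by (simp add: mult.commute)

text \<open>The expectation of 1/(j+1) for a binomial \<open>j\<close>. Absorbing j+1 into the
  coefficient turns the terms into those of (p+q)^(k+1) without the zeroth one. This converts the
  gain per flip into a gain per convolution factor.\<close>

lemma binomial_weighted_sum_le: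
  fixes p q :: real
  assumes "p > 0" "q \<ge> 0" "p + q = 1"
  shows "(\<Sum>j\<le>k. real (k choose j) * p ^ j * q ^ (k - j) / (real j + 1)) \<le> 1 / (p * (real k + 1))"
proof -
  have e: "real (k choose j) * p ^ j * q ^ (k - j) / (real j + 1) * (p * (real k + 1))
      = real (Suc k choose Suc j) * p ^ Suc j * q ^ (Suc k - Suc j)" for j
  proof -
    have "real (Suc j) * real (Suc k choose Suc j) = real (Suc k) * real (k choose j)"
      using Suc_times_binomial[of j k] by (metis of_nat_mult)
    then have "real (Suc k choose Suc j) = (real k + 1) * real (k choose j) / (real j + 1)"
      by (simp add: field_simps del: binomial_Suc_Suc)
    then show ?thesis by (simp del: binomial_Suc_Suc)
  qed
  have "(\<Sum>j\<le>k. real (k choose j) * p ^ j * q ^ (k - j) / (real j + 1)) * (p * (real k + 1))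
      = (\<Sum>j\<le>k. real (Suc k choose Suc j) * p ^ Suc j * q ^ (Suc k - Suc j))"
    unfolding sum_distrib_right e ..
  also have "\<dots> \<le> (\<Sum>j\<le>Suc k. real (Suc k choose j) * p ^ j * q ^ (Suc k - j))"
    unfolding sum.atMost_Suc_shift using assms by simp
  also have "\<dots> = 1"
    using binomial_ring[of p q "Suc k"] assms by simp
  finally show ?thesis using assms by (subst pos_le_divide_eq) auto
qed

text \<open>A step with density \<open>J\<close> is, with probability the mass of \<open>G\<close>,
  a fair sign times \<open>a\<close> plus a sample of the normalised \<open>G\<close>, and otherwise
  a sample of the normalised \<open>H\<close>. Evenness of \<open>G\<close> and \<open>H\<close>
  removes odd terms from the moments, and the positive mass of \<open>G\<close> guarantees enough
  flips.\<close>

locale split_kernel =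
  fixes J G H :: "'a::euclidean_space \<Rightarrow> real" and a :: 'a and R :: real
  assumes ccs_J: "ccs J" and ccs_G: "ccs G" and ccs_H: "ccs H"
    and J_nonneg: "\<And>x. J x \<ge> 0" and G_nonneg: "\<And>x. G x \<ge> 0" and H_nonneg: "\<And>x. H x \<ge> 0"
    and G_even: "\<And>x. G (- x) = G x" and H_even: "\<And>x. H (- x) = H x"
    and J_supp: "\<And>x. norm x > R \<Longrightarrow> J x = 0"
    and G_supp: "\<And>x. norm x > R \<Longrightarrow> G x = 0"
    and H_supp: "\<And>x. norm x > R \<Longrightarrow> H x = 0"
    and R_nonneg: "R \<ge> 0"
    and J_split: "\<And>x. J x = (G (x - a) + G (x + a)) / 2 + H x"
    and J_integral: "(LINT x|lborel. J x) = 1"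
    and G_integral: "(LINT x|lborel. G x) > 0"
begin

definition p where "p = (LINT x|lborel. G x)"
definition q where "q = (LINT x|lborel. H x)"

lemma p_pos: "p > 0" and q_nonneg: "q \<ge> 0"
  using G_integral H_nonneg by (auto simp: p_def q_def)

lemma p_plus_q: "p + q = 1"
proof -
  have "J = (\<lambda>x. (G (x - a) + G (x + a)) / 2 + H x)"
    by (rule ext) (rule J_split)
  then have "(LINT x|lborel. J x) = (LINT x|lborel. (G (x - a) + G (x + a)) / 2 + H x)"
    by simp
  also have "\<dots> = ((LINT x|lborel. G (x - a)) + (LINT x|lborel. G (x + a))) / 2 + q"
    using ccs_integrable[OF ccs_shift[OF ccs_G, of a]] ccs_integrable[OF ccs_shift[OF ccs_G, of "- a"]]
      ccs_integrable[OF ccs_H] by (simp add: q_def)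
  also have "\<dots> = p + q"
    using lborel_integral_shift[OF ccs_measurable[OF ccs_G], of a]
      lborel_integral_shift[OF ccs_measurable[OF ccs_G], of "- a"] by (simp add: p_def)
  finally show ?thesis using J_integral by simp
qed

text \<open>\<open>layer k j\<close> is the contribution of the terms in the expansion of the \<open>k + 1\<close>-fold
  convolution power (keeping the last factor \<open>J\<close> unsplit) with exactly \<open>j\<close> factors \<open>G\<close>,
  before the \<open>j\<close> coin flips \<open>\<plusminus> a\<close> are carried out.\<close>

primrec layer :: "nat \<Rightarrow> nat \<Rightarrow> 'a \<Rightarrow> real" where
  "layer 0 j = (if j = 0 then J else (\<lambda>x. 0))"
| "layer (Suc k) j = (\<lambda>x. conv H (layer k j) x + (case j of 0 \<Rightarrow> 0 | Suc i \<Rightarrow> conv G (layer k i) x))"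

lemma layer_ccs: "ccs (layer k j)"
proof (induction k arbitrary: j)
  case 0
  show ?case using ccs_J by simp
next
  case (Suc k)
  show ?case
    by (cases j) (auto intro!: ccs_add ccs_conv ccs_G ccs_H Suc)
qed

lemma layer_nonneg: "layer k j x \<ge> 0"
proof (induction k arbitrary: j x)
  case 0
  show ?case using J_nonneg by simp
next
  case (Suc k)
  show ?case
    by (cases j) (auto intro!: add_nonneg_nonneg conv_nonneg G_nonneg H_nonneg Suc)
qed

lemma layer_eq_0: "j > k \<Longrightarrow> layer k j = (\<lambda>x. 0)"
proof (induction k arbitrary: j)
  case (Suc k)
  then show ?case by (cases j) (auto simp: conv_def)
qed simp

section \<open>Mass and moments of the layers\<close>

definition moments_le :: "real \<Rightarrow> real \<Rightarrow> ('a \<Rightarrow> real) \<Rightarrow> bool" where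
  "moments_le n b L \<longleftrightarrow> (LINT x|lborel. L x) = b \<and>
     (LINT x|lborel. norm x ^ 2 * L x) \<le> n * R ^ 2 * b \<and>
     (LINT x|lborel. norm x ^ 4 * L x) \<le> 3 * n ^ 2 * R ^ 4 * b"

lemma moments_le_0: "moments_le n 0 (\<lambda>x. 0)"
  by (simp add: moments_le_def)

lemma moments_le_add:
  assumes "moments_le n b L" "moments_le n c M" "ccs L" "ccs M"
  shows "moments_le n (b + c) (\<lambda>x. L x + M x)"
proof -
  have "integrable lborel (\<lambda>x. norm x ^ i * L x)" "integrable lborel (\<lambda>x. norm x ^ i * M x)" for i
    by (intro ccs_integrable ccs_mult continuous_intros assms)+
  then show ?thesis
    using assms ccs_integrable[OF assms(3)] ccs_integrable[OF assms(4)]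
    by (auto simp: moments_le_def distrib_left)
qed

text \<open>The factor 3 in \<open>moments_le\<close> is chosen to close this step: 3 n^2 + 6 n + 1
  is at most 3 (n+1)^2.\<close>

lemma moments_le_conv:
  assumes "ccs f" "\<And>x. f x \<ge> 0" "\<And>x. f (- x) = f x" "\<And>x. norm x > R \<Longrightarrow> f x = 0"
    and L: "ccs L" "\<And>x. L x \<ge> 0" "moments_le n b L"
  shows "moments_le (n + 1) ((LINT x|lborel. f x) * b) (conv f L)"
proof -
  have f0: "(LINT x|lborel. f x) \<ge> 0" using assms by simp
  have b: "b \<ge> 0" using L by (auto simp: moments_le_def)
  have 0: "(LINT x|lborel. L x) = b" and 2: "(LINT x|lborel. norm x ^ 2 * L x) \<le> n * R ^ 2 * b"
    and 4: "(LINT x|lborel. norm x ^ 4 * L x) \<le> 3 * n ^ 2 * R ^ 4 * b"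
    using L(3) by (auto simp: moments_le_def)
  have "(LINT x|lborel. norm x ^ 2 * conv f L x)
      \<le> (LINT x|lborel. f x) * ((LINT x|lborel. norm x ^ 2 * L x) + R ^ 2 * b)"
    using conv_moment_le(1)[OF assms(1-4) L(1,2)] 0 by simp
  also have "\<dots> \<le> (LINT x|lborel. f x) * (n * R ^ 2 * b + R ^ 2 * b)"
    by (intro mult_left_mono add_mono 2 f0) auto
  finally have m2: "(LINT x|lborel. norm x ^ 2 * conv f L x) \<le> (n + 1) * R ^ 2 * ((LINT x|lborel. f x) * b)"
    by (simp add: algebra_simps)
  have "(LINT x|lborel. norm x ^ 4 * conv f L x)
      \<le> (LINT x|lborel. f x) * ((LINT x|lborel. norm x ^ 4 * L x)
           + 6 * R ^ 2 * (LINT x|lborel. norm x ^ 2 * L x) + R ^ 4 * b)"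
    using conv_moment_le(2)[OF assms(1-4) L(1,2)] 0 by simp
  also have "\<dots> \<le> (LINT x|lborel. f x) * (3 * n ^ 2 * R ^ 4 * b + 6 * R ^ 2 * (n * R ^ 2 * b) + R ^ 4 * b)"
    by (intro mult_left_mono add_mono 4 2 f0) auto
  also have "\<dots> = (3 * n ^ 2 + 6 * n + 1) * (R ^ 4 * ((LINT x|lborel. f x) * b))"
    by (simp add: algebra_simps eval_nat_numeral)
  also have "\<dots> \<le> (3 * (n + 1) ^ 2) * (R ^ 4 * ((LINT x|lborel. f x) * b))"
    using f0 b by (intro mult_right_mono) (auto simp: power2_eq_square algebra_simps)
  finally have m4: "(LINT x|lborel. norm x ^ 4 * conv f L x) \<le> 3 * (n + 1) ^ 2 * R ^ 4 * ((LINT x|lborel. f x) * b)"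
    by (simp add: mult.assoc)
  show ?thesis
    unfolding moments_le_def using m2 m4 integral_conv_1[OF assms(1) L(1)] 0 by simp
qed

text \<open>The binomial distribution. Truncated subtraction for \<open>j > k\<close> is harmless,
  as the binomial coefficient vanishes there.\<close>

definition weight :: "nat \<Rightarrow> nat \<Rightarrow> real" where
  "weight k j = real (k choose j) * p ^ j * q ^ (k - j)"

lemma weight_Suc:
  "weight (Suc k) j = q * weight k j + (case j of 0 \<Rightarrow> 0 | Suc i \<Rightarrow> p * weight k i)"
proof (cases j)
  case (Suc i)
  have "real (k choose Suc i) * q ^ (k - i) = q * (real (k choose Suc i) * q ^ (k - Suc i))"
  proof (cases "Suc i \<le> k")
    case True
    then have "k - i = Suc (k - Suc i)" by simp
    then show ?thesis by simp
  qed (simp add: binomial_eq_0)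
  then show ?thesis by (simp add: weight_def Suc algebra_simps)
qed (simp add: weight_def)

lemma weight_nonneg: "weight k j \<ge> 0"
  using p_pos q_nonneg by (simp add: weight_def)

text \<open>The step count is k+1: the \<open>k\<close> split factors and the unsplit
  \<open>J\<close>. Pascal's rule for \<open>weight\<close> matches the recursion of
  \<open>layer\<close>.\<close>

lemma layer_moments: "moments_le (real k + 1) (weight k j) (layer k j)"
proof (induction k arbitrary: j)
  case 0
  show ?case
  proof (cases "j = 0")
    case True
    have "(LINT x|lborel. norm x ^ i * J x) \<le> R ^ i" for i
    proof -
      have "(LINT x|lborel. norm x ^ i * J x) \<le> (LINT x|lborel. R ^ i * J x)"
      proof (rule integral_mono)
        show "norm x ^ i * J x \<le> R ^ i * J x" for x
          using J_supp[of x] J_nonneg[of x] R_nonneg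
          by (cases "norm x > R") (auto intro!: mult_right_mono power_mono)
      qed (intro ccs_integrable ccs_mult continuous_intros ccs_J)+
      then show ?thesis using J_integral by simp
    qed
    from this[of 2] this[of 4] show ?thesis
      using True J_integral R_nonneg by (auto simp: moments_le_def weight_def intro: order.trans)
  qed (simp add: moments_le_0 weight_def binomial_eq_0)
next
  case (Suc k)
  have H: "moments_le (real k + 1 + 1) (q * weight k j) (conv H (layer k j))" for j
    unfolding q_def by (intro moments_le_conv ccs_H H_nonneg H_even H_supp layer_ccs layer_nonneg Suc)
  have G: "moments_le (real k + 1 + 1) (p * weight k j) (conv G (layer k j))" for j
    unfolding p_def by (intro moments_le_conv ccs_G G_nonneg G_even G_supp layer_ccs layer_nonneg Suc)
  show ?case
  proof (cases j)
    case 0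
    then show ?thesis using H[of 0] by (simp add: weight_Suc add.commute)
  next
    case (Suc i)
    have "moments_le (real k + 1 + 1) (q * weight k j + p * weight k i)
       (\<lambda>x. conv H (layer k j) x + conv G (layer k i) x)"
      by (intro moments_le_add H G ccs_conv ccs_H ccs_G layer_ccs)
    then show ?thesis by (simp add: weight_Suc Suc add.commute)
  qed
qed

section \<open>Expansion of the convolution powers along the walk\<close>

lemma layer_shift_continuous: "continuous_on UNIV (\<lambda>x. layer k j (x - c))"
  by (rule continuous_on_compose2[OF ccs_continuous[OF layer_ccs]]) (auto intro!: continuous_intros)

lemma conv_walk_mean:
  assumes "ccs f"
  shows "conv f (\<lambda>x. walk_mean j (\<lambda>m. layer k i (x - of_int m *\<^sub>R a))) x
    = walk_mean j (\<lambda>m. conv f (layer k i) (x - of_int m *\<^sub>R a))"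
  unfolding walk_mean_def
  using conv_shift_right[OF assms ccs_continuous[OF layer_ccs], of k i "- (of_int m *\<^sub>R a)" x for m]
  by (subst conv_sum_right)
     (auto intro!: continuous_intros layer_shift_continuous assms simp: conv_cmult_right)

lemma conv_J:
  assumes "continuous_on UNIV u"
  shows "conv J u x = (conv G u (x - a) + conv G u (x + a)) / 2 + conv H u x"
proof -
  note cG = ccs_shift[OF ccs_G]
  have "J = (\<lambda>x. 1 / 2 * (G (x + - a) + G (x + a)) + H x)"
    by (rule ext) (simp add: J_split)
  then have "conv J u x = conv (\<lambda>x. 1 / 2 * (G (x + - a) + G (x + a)) + H x) u x"
    by simp
  also have "\<dots> = conv (\<lambda>x. 1 / 2 * (G (x + - a) + G (x + a))) u x + conv H u x"
    by (intro conv_add_left ccs_cmult ccs_add cG ccs_H assms)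
  also have "conv (\<lambda>x. 1 / 2 * (G (x + - a) + G (x + a))) u x
      = 1 / 2 * conv (\<lambda>x. G (x + - a) + G (x + a)) u x"
    by (rule conv_cmult_left)
  also have "conv (\<lambda>x. G (x + - a) + G (x + a)) u x
      = conv (\<lambda>x. G (x + - a)) u x + conv (\<lambda>x. G (x + a)) u x"
    by (intro conv_add_left cG assms)
  finally show ?thesis by (simp only: conv_shift_left) simp
qed

text \<open>Translations commute with convolution, so all flips can be collected outside: a factor
  \<open>G\<close> comes with one more step of the walk, a factor \<open>H\<close> leaves the walk
  where it is.\<close>

lemma conv_power_expansion:
  "conv_power J k x = (\<Sum>j\<le>k. walk_mean j (\<lambda>m. layer k j (x - of_int m *\<^sub>R a)))"
proof (induction k arbitrary: x)
  case (Suc k)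
  have u: "conv_power J k = (\<lambda>x. \<Sum>j\<le>k. walk_mean j (\<lambda>m. layer k j (x - of_int m *\<^sub>R a)))"
    by (rule ext) (rule Suc)
  have c: "continuous_on UNIV (\<lambda>x. walk_mean j (\<lambda>m. layer k j (x - of_int m *\<^sub>R a)))" for j
    unfolding walk_mean_def by (intro continuous_intros layer_shift_continuous)
  have e: "conv f (conv_power J k) x = (\<Sum>j\<le>k. walk_mean j (\<lambda>m. conv f (layer k j) (x - of_int m *\<^sub>R a)))"
    if "ccs f" for f x
    unfolding u by (subst conv_sum_right) (auto simp: conv_walk_mean that c)
  have G: "(conv G (conv_power J k) (x - a) + conv G (conv_power J k) (x + a)) / 2
      = (\<Sum>j\<le>k. walk_mean (Suc j) (\<lambda>m. conv G (layer k j) (x - of_int m *\<^sub>R a)))"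
    unfolding e[OF ccs_G] sum.distrib[symmetric] sum_divide_distrib walk_mean_Suc
    by (simp add: algebra_simps)
  have "conv_power J (Suc k) x
      = (\<Sum>j\<le>k. walk_mean (Suc j) (\<lambda>m. conv G (layer k j) (x - of_int m *\<^sub>R a)))
        + (\<Sum>j\<le>k. walk_mean j (\<lambda>m. conv H (layer k j) (x - of_int m *\<^sub>R a)))"
    using conv_J[OF ccs_continuous[OF ccs_conv_power[OF ccs_J]]] G e[OF ccs_H] by simp
  \<comment> \<open>Both sums are brought to the range up to \<open>Suc k\<close>: here the added
    layer is zero, below the index is shifted and the added term is the one at 0.\<close>
  also have "(\<Sum>j\<le>k. walk_mean j (\<lambda>m. conv H (layer k j) (x - of_int m *\<^sub>R a)))
     = (\<Sum>j\<le>Suc k. walk_mean j (\<lambda>m. conv H (layer k j) (x - of_int m *\<^sub>R a)))"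
    using layer_eq_0[of k "Suc k"] by (simp add: conv_def)
  also have "(\<Sum>j\<le>k. walk_mean (Suc j) (\<lambda>m. conv G (layer k j) (x - of_int m *\<^sub>R a)))
     = (\<Sum>j\<le>Suc k. walk_mean j (\<lambda>m. case j of 0 \<Rightarrow> 0 | Suc i \<Rightarrow> conv G (layer k i) (x - of_int m *\<^sub>R a)))"
    unfolding sum.atMost_Suc_shift by simp
  finally show ?case
    by (simp add: sum.distrib[symmetric] walk_mean_add[symmetric] add.commute del: sum.atMost_Suc)
qed simp

text \<open>A translation by \<open>a\<close> is a unit shift of the walk, so
  \<open>walk_mean_diff\<close> applies to each layer separately.\<close>

lemma conv_power_diff:
  "conv_power J k (x - a) - conv_power J k (x + a)
    = (\<Sum>j\<le>k. 2 / (real j + 1) * walk_mean (Suc j) (\<lambda>m. of_int m * layer k j (x - of_int m *\<^sub>R a)))"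
proof -
  have "conv_power J k (x - a) - conv_power J k (x + a)
    = (\<Sum>j\<le>k. walk_mean j (\<lambda>m. layer k j (x - of_int (m + 1) *\<^sub>R a))
           - walk_mean j (\<lambda>m. layer k j (x - of_int (m - 1) *\<^sub>R a)))"
    unfolding conv_power_expansion sum_subtractf by (simp add: algebra_simps)
  then show ?thesis
    by (simp only: walk_mean_diff[of _ "\<lambda>m. layer k _ (x - of_int m *\<^sub>R a)"])
qed

text \<open>Substituting \<open>x = y + of_int m *\<^sub>R a\<close> term by term fixes the argument
  of the layer and moves the set instead. For fixed \<open>y\<close> at most \<open>K\<close> values
  of \<open>m\<close> survive, so suprema over \<open>m\<close> replace the sum over
  \<open>m\<close>. The fifth power of \<open>m\<close> is the factor from the walk identity times
  the fourth power from expanding the norm of \<open>x\<close>. The constants are 8 * 4 * 3 and 8 *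
  192, the 8 coming from (u+v)^4 \<le> 8 (u^4 + v^4).\<close>

lemma layer_walk_integral_le:
  assumes S: "S \<in> sets borel"
    and overlap: "\<And>y. finite {m::int. y + of_int m *\<^sub>R a \<in> S}"
      "\<And>y. real (card {m::int. y + of_int m *\<^sub>R a \<in> S}) \<le> K"
    and n: "n \<le> k + 1"
  shows "(LINT x|lborel. indicator S x * norm x ^ 4 *
            walk_mean n (\<lambda>m. \<bar>of_int m\<bar> * layer k j (x - of_int m *\<^sub>R a)))
      \<le> K * (96 * R ^ 4 + 1536 * norm a ^ 4) * (real k + 1) ^ 2 * weight k j"
proof -
  let ?I = "{- int n..int n}"
  let ?L = "layer k j"
  have K: "K \<ge> 0" using overlap(2)[of 0] by linarith
  define F where "F = (\<lambda>m y. srw n m * \<bar>of_int m\<bar> * (indicator S (y + of_int m *\<^sub>R a)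
      * norm (y + of_int m *\<^sub>R a) ^ 4 * ?L y))"
  define T where "T = (\<lambda>m x. srw n m * \<bar>of_int m\<bar> * (indicator S x * (norm x ^ 4 * ?L (x - of_int m *\<^sub>R a))))"
  have cc: "ccs (\<lambda>x. norm x ^ 4 * ?L (x - of_int m *\<^sub>R a))" for m
    using ccs_mult[of "\<lambda>x. norm x ^ 4", OF _ ccs_shift[OF layer_ccs[of k j], of "- (of_int m *\<^sub>R a)"]]
    by (simp add: continuous_intros)
  have iT: "integrable lborel (T m)" for m
    unfolding T_def by (intro integrable_mult_right integrable_indicator_ccs cc S)
  have T_F: "(\<lambda>x. T m (x + of_int m *\<^sub>R a)) = F m" for m
    by (auto simp: T_def F_def)
  have Tm: "T m \<in> borel_measurable borel" for m
    using borel_measurable_integrable[OF iT] by simp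
  have iF: "integrable lborel (F m)" for m
  proof -
    have "integrable (distr lborel borel ((+) (of_int m *\<^sub>R a))) (T m)"
      by (simp add: lborel_distr_plus iT)
    then have "integrable lborel (\<lambda>x. T m (of_int m *\<^sub>R a + x))"
      by (subst (asm) integrable_distr_eq) (use Tm in auto)
    then show ?thesis using T_F[of m] by (simp add: add.commute)
  qed
  have "(LINT x|lborel. indicator S x * norm x ^ 4 *
            walk_mean n (\<lambda>m. \<bar>of_int m\<bar> * ?L (x - of_int m *\<^sub>R a)))
      = (LINT x|lborel. (\<Sum>m\<in>?I. T m x))"
    unfolding walk_mean_def sum_distrib_left T_def by (simp add: mult_ac)
  also have "\<dots> = (\<Sum>m\<in>?I. (LINT x|lborel. T m x))"
    by (intro Bochner_Integration.integral_sum iT)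
  also have "\<dots> = (\<Sum>m\<in>?I. (LINT y|lborel. F m y))"
    using lborel_integral_shift[OF Tm] T_F by metis
  also have "\<dots> = (LINT y|lborel. (\<Sum>m\<in>?I. F m y))"
    by (intro Bochner_Integration.integral_sum[symmetric] iF)
  also have "\<dots> \<le> (LINT y|lborel. 8 * K * (4 * (norm y ^ 4 * ?L y) + 192 * real n ^ 2 * norm a ^ 4 * ?L y))"
  proof (rule integral_mono)
    show "integrable lborel (\<lambda>y. \<Sum>m\<in>?I. F m y)"
      by (intro Bochner_Integration.integrable_sum iF)
    show "integrable lborel (\<lambda>y. 8 * K * (4 * (norm y ^ 4 * ?L y) + 192 * real n ^ 2 * norm a ^ 4 * ?L y))"
      by (intro integrable_mult_right Bochner_Integration.integrable_add ccs_integrable ccs_mult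
            layer_ccs continuous_intros)
    fix y
    let ?M = "{m::int. y + of_int m *\<^sub>R a \<in> S}"
    let ?c = "8 * (4 * norm y ^ 4 + 192 * real n ^ 2 * norm a ^ 4) * ?L y"
    have c: "?c \<ge> 0" by (intro mult_nonneg_nonneg layer_nonneg) auto
    have b: "F m y \<le> ?c" for m
    proof -
      have "norm (y + of_int m *\<^sub>R a) ^ 4 \<le> (norm y + \<bar>of_int m\<bar> * norm a) ^ 4"
        using norm_triangle_ineq[of y "of_int m *\<^sub>R a"] by (intro power_mono) auto
      also have "\<dots> \<le> 8 * (norm y ^ 4 + (\<bar>of_int m\<bar> * norm a) ^ 4)"
      proof -
        have sq: "(u + v) ^ 2 \<le> 2 * (u ^ 2 + v ^ 2)" for u v :: real
          using sum_squares_bound[of u v] by (simp add: power2_eq_square algebra_simps)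
        have "((norm y + \<bar>of_int m\<bar> * norm a) ^ 2) ^ 2 \<le> (2 * (norm y ^ 2 + (\<bar>of_int m\<bar> * norm a) ^ 2)) ^ 2"
          by (intro power_mono sq) auto
        also have "\<dots> \<le> 4 * (2 * ((norm y ^ 2) ^ 2 + ((\<bar>of_int m\<bar> * norm a) ^ 2) ^ 2))"
          unfolding power_mult_distrib[of 2] using sq[of "norm y ^ 2" "(\<bar>of_int m\<bar> * norm a) ^ 2"] by simp
        finally show ?thesis by simp
      qed
      finally have d: "norm (y + of_int m *\<^sub>R a) ^ 4 \<le> 8 * (norm y ^ 4 + (\<bar>of_int m\<bar> * norm a) ^ 4)" .
      have "F m y \<le> srw n m * \<bar>of_int m\<bar> * (1 * (8 * (norm y ^ 4 + (\<bar>of_int m\<bar> * norm a) ^ 4)) * ?L y)"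
        unfolding F_def
        by (intro mult_left_mono mult_right_mono mult_mono d layer_nonneg mult_nonneg_nonneg srw_nonneg)
           (auto simp: indicator_def)
      also have "\<dots> = 8 * ((\<bar>of_int m\<bar> * srw n m) * norm y ^ 4 + (\<bar>of_int m\<bar> ^ 5 * srw n m) * norm a ^ 4) * ?L y"
        by (simp add: algebra_simps eval_nat_numeral)
      also have "\<dots> \<le> ?c"
        by (intro mult_right_mono mult_left_mono add_mono srw_abs_le srw_abs5_le layer_nonneg) auto
      finally show ?thesis .
    qed
    have z: "F m y = 0" if "m \<notin> ?M" for m
      using that by (simp add: F_def)
    have "(\<Sum>m\<in>?I. F m y) = (\<Sum>m\<in>?I \<inter> ?M. F m y)"
      by (intro sum.mono_neutral_right) (use z in auto)
    also have "\<dots> \<le> (\<Sum>m\<in>?I \<inter> ?M. ?c)"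
      by (intro sum_mono b)
    also have "\<dots> = real (card (?I \<inter> ?M)) * ?c" by simp
    also have "\<dots> \<le> K * ?c"
    proof (intro mult_right_mono c)
      have "card (?I \<inter> ?M) \<le> card ?M" by (intro card_mono overlap(1)) auto
      then show "real (card (?I \<inter> ?M)) \<le> K" using overlap(2)[of y] by linarith
    qed
    finally show "(\<Sum>m\<in>?I. F m y) \<le> 8 * K * (4 * (norm y ^ 4 * ?L y) + 192 * real n ^ 2 * norm a ^ 4 * ?L y)"
      by (simp add: algebra_simps)
  qed
  also have "\<dots> = 8 * K * (4 * (LINT y|lborel. norm y ^ 4 * ?L y)
      + 192 * real n ^ 2 * norm a ^ 4 * (LINT y|lborel. ?L y))"
  proof -
    have "integrable lborel (\<lambda>y. norm y ^ 4 * ?L y)"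
      by (intro ccs_integrable ccs_mult layer_ccs continuous_intros)
    then show ?thesis using ccs_integrable[OF layer_ccs[of k j]] by simp
  qed
  also have "\<dots> \<le> 8 * K * (4 * (3 * (real k + 1) ^ 2 * R ^ 4 * weight k j)
      + 192 * (real k + 1) ^ 2 * norm a ^ 4 * weight k j)"
    using layer_moments[of k j] K n weight_nonneg[of k j]
    by (intro mult_left_mono mult_right_mono add_mono power_mono mult_mono) (auto simp: moments_le_def)
  also have "\<dots> = K * (96 * R ^ 4 + 1536 * norm a ^ 4) * (real k + 1) ^ 2 * weight k j"
    by (simp add: algebra_simps)
  finally show ?thesis .
qed

text \<open>The layers cost (k+1)^2 times their weights, and the factors 2/(j+1) average to a
  multiple of 1/(k+1), leaving one power of k+1. The walk has \<open>Suc j\<close> steps, at most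
  k+1.\<close>

lemma conv_power_diff_integral_le:
  assumes S: "S \<in> sets borel"
    and overlap: "\<And>y. finite {m::int. y + of_int m *\<^sub>R a \<in> S}"
      "\<And>y. real (card {m::int. y + of_int m *\<^sub>R a \<in> S}) \<le> K"
  shows "(LINT x|lborel. indicator S x * norm x ^ 4 * \<bar>conv_power J k (x - a) - conv_power J k (x + a)\<bar>)
      \<le> 2 * K * (96 * R ^ 4 + 1536 * norm a ^ 4) / p * (real k + 1)"
proof -
  let ?W = "\<lambda>j x. walk_mean (Suc j) (\<lambda>m. \<bar>of_int m\<bar> * layer k j (x - of_int m *\<^sub>R a))"
  let ?c = "K * (96 * R ^ 4 + 1536 * norm a ^ 4)"
  have K: "K \<ge> 0" using overlap(2)[of 0] by linarith
  have sh: "ccs (\<lambda>x. conv_power J k (x + c))" for c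
    by (intro ccs_shift ccs_conv_power ccs_J)
  have iW: "integrable lborel (\<lambda>x. indicator S x * norm x ^ 4 * ?W j x)" for j
  proof -
    have "ccs (\<lambda>x. ?W j x)"
      unfolding walk_mean_def
      using ccs_shift[OF layer_ccs[of k j], of "- (of_int m *\<^sub>R a)" for m]
      by (intro ccs_sum ccs_cmult) (simp add: ccs_cmult)
    then show ?thesis
      unfolding mult.assoc by (intro integrable_indicator_ccs S ccs_mult continuous_intros)
  qed
  have le: "\<bar>conv_power J k (x - a) - conv_power J k (x + a)\<bar> \<le> (\<Sum>j\<le>k. 2 / (real j + 1) * ?W j x)" for x
  proof -
    have "\<bar>conv_power J k (x - a) - conv_power J k (x + a)\<bar>
        \<le> (\<Sum>j\<le>k. \<bar>2 / (real j + 1) * walk_mean (Suc j) (\<lambda>m. of_int m * layer k j (x - of_int m *\<^sub>R a))\<bar>)"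
      unfolding conv_power_diff by (rule sum_abs)
    also have "\<dots> \<le> (\<Sum>j\<le>k. 2 / (real j + 1) * ?W j x)"
    proof (rule sum_mono)
      fix j
      have "\<bar>walk_mean (Suc j) (\<lambda>m. of_int m * layer k j (x - of_int m *\<^sub>R a))\<bar> \<le> ?W j x"
        using abs_walk_mean_le[of "Suc j" "\<lambda>m. of_int m * layer k j (x - of_int m *\<^sub>R a)"]
        by (simp add: abs_mult layer_nonneg)
      then have "2 / (real j + 1) * \<bar>walk_mean (Suc j) (\<lambda>m. of_int m * layer k j (x - of_int m *\<^sub>R a))\<bar>
          \<le> 2 / (real j + 1) * ?W j x"
        by (intro mult_left_mono) auto
      then show "\<bar>2 / (real j + 1) * walk_mean (Suc j) (\<lambda>m. of_int m * layer k j (x - of_int m *\<^sub>R a))\<bar>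
          \<le> 2 / (real j + 1) * ?W j x"
        by (simp only: abs_mult) simp
    qed
    finally show ?thesis .
  qed
  have "(LINT x|lborel. indicator S x * norm x ^ 4 * \<bar>conv_power J k (x - a) - conv_power J k (x + a)\<bar>)
      \<le> (LINT x|lborel. (\<Sum>j\<le>k. 2 / (real j + 1) * (indicator S x * norm x ^ 4 * ?W j x)))"
  proof (rule integral_mono)
    have "ccs (\<lambda>x. norm x ^ 4 * (conv_power J k (x + - a) - conv_power J k (x + a)))"
      by (intro ccs_mult ccs_diff sh continuous_intros)
    from integrable_abs[OF integrable_indicator_ccs[OF this S]]
    show "integrable lborel (\<lambda>x. indicator S x * norm x ^ 4 * \<bar>conv_power J k (x - a) - conv_power J k (x + a)\<bar>)"
      by (simp add: abs_mult mult.assoc)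
    show "integrable lborel (\<lambda>x. \<Sum>j\<le>k. 2 / (real j + 1) * (indicator S x * norm x ^ 4 * ?W j x))"
      by (intro Bochner_Integration.integrable_sum integrable_mult_right iW)
    show "indicator S x * norm x ^ 4 * \<bar>conv_power J k (x - a) - conv_power J k (x + a)\<bar>
        \<le> (\<Sum>j\<le>k. 2 / (real j + 1) * (indicator S x * norm x ^ 4 * ?W j x))" for x
      using mult_left_mono[OF le[of x], of "indicator S x * norm x ^ 4"]
      by (simp add: sum_distrib_left mult_ac)
  qed
  also have "\<dots> = (\<Sum>j\<le>k. 2 / (real j + 1) * (LINT x|lborel. indicator S x * norm x ^ 4 * ?W j x))"
    by (subst Bochner_Integration.integral_sum)
       (auto intro!: integrable_mult_right iW simp del: of_nat_Suc simp: iW)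
  also have "\<dots> \<le> (\<Sum>j\<le>k. 2 / (real j + 1) * (?c * (real k + 1) ^ 2 * weight k j))"
    by (intro sum_mono mult_left_mono layer_walk_integral_le S overlap) auto
  also have "\<dots> = 2 * ?c * (real k + 1) ^ 2 * (\<Sum>j\<le>k. weight k j / (real j + 1))"
    unfolding sum_distrib_left by (intro sum.cong refl) simp
  also have "\<dots> \<le> 2 * ?c * (real k + 1) ^ 2 * (1 / (p * (real k + 1)))"
    using K binomial_weighted_sum_le[OF p_pos q_nonneg p_plus_q, of k]
    by (intro mult_left_mono) (auto simp: weight_def)
  also have "\<dots> = 2 * K * (96 * R ^ 4 + 1536 * norm a ^ 4) / p * (real k + 1)"
    using p_pos by (simp add: power2_eq_square divide_simps)
  finally show ?thesis .
qed

end

subsection \<open>Increments of the convolution powers on sectors of thin shells\<close>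

text \<open>\<open>J\<close> is bounded below near some nonzero \<open>a0\<close> and, being even,
  near its negative; a small tent fits under it at both places. Each bump enters with weight 1/2 and
  lies below \<open>J\<close>, so the rest is nonnegative even where bumps overlap. The same
  \<open>G\<close> and \<open>R\<close> serve all \<open>a\<close> near \<open>a0\<close>.\<close>

lemma kernel_splitting:
  fixes J :: "'a::euclidean_space \<Rightarrow> real"
  assumes ccs: "ccs J" and nonneg: "\<And>x. J x \<ge> 0" and even: "\<And>x. J (- x) = J x"
    and int: "(LINT x|lborel. J x) = 1"
  obtains a0 \<epsilon> R G H where "a0 \<noteq> 0" "\<epsilon> > 0" "\<epsilon> \<le> norm a0 / 4"
    "\<And>a. norm (a - a0) \<le> \<epsilon> \<Longrightarrow> split_kernel J G (H a) a R"
proof -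
  have "\<exists>a0. a0 \<noteq> 0 \<and> J a0 > 0"
  proof (rule ccontr)
    assume "\<not> (\<exists>a0. a0 \<noteq> 0 \<and> J a0 > 0)"
    then have z: "J x = 0" if "x \<noteq> 0" for x
      using that nonneg[of x] by (auto simp: less_eq_real_def)
    have "AE x in lborel. J x = 0"
      using AE_lborel_singleton[of "0 :: 'a"] by (rule AE_mp) (use z in auto)
    then have "(LINT x|lborel. J x) = 0"
      by (rule integral_eq_zero_AE)
    then show False using int by simp
  qed
  then obtain a0 where a0: "a0 \<noteq> 0" "J a0 > 0" by blast
  define c where "c = J a0 / 2"
  have c: "c > 0" using a0 by (simp add: c_def)
  have "isCont J a0" using ccs_continuous[OF ccs] by (simp add: continuous_on_eq_continuous_at)
  then obtain d where d: "d > 0" "\<And>x. norm (x - a0) < d \<Longrightarrow> \<bar>J x - J a0\<bar> < c"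
    using c unfolding continuous_at_eps_delta dist_norm real_norm_def by metis
  have Jc: "J x \<ge> c" if "norm (x - a0) < d" for x
    using d(2)[OF that] by (simp add: c_def abs_real_def field_simps split: if_splits)
  have Jc': "J x \<ge> c" if "norm (x + a0) < d" for x
    using Jc[of "- x"] even[of x] that by (metis minus_add_distrib norm_minus_cancel uminus_add_conv_diff diff_conv_add_uminus add.commute)
  \<comment> \<open>Half of \<open>d\<close> leaves room for both the radius of the tent and the
    displacement of \<open>a\<close> from \<open>a0\<close>; a quarter of the norm of
    \<open>a0\<close> is the tilt allowed in \<open>shell_sector_step\<close>.\<close>
  define \<epsilon> where "\<epsilon> = min (d / 2) (norm a0 / 4)"
  have \<epsilon>: "\<epsilon> > 0" "\<epsilon> \<le> norm a0 / 4" "\<epsilon> \<le> d / 2" using d a0 by (auto simp: \<epsilon>_def)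
  define G where "G = (\<lambda>x::'a. c * max 0 (1 - norm x / \<epsilon>))"
  have G0: "G x = 0" if "norm x \<ge> \<epsilon>" for x
    using that \<epsilon> by (auto simp: G_def max_def field_simps)
  have Gc: "0 \<le> G x \<and> G x \<le> c" for x
  proof -
    have "max 0 (1 - norm x / \<epsilon>) \<le> 1" using \<epsilon> by auto
    then show ?thesis using c mult_left_mono[of "max 0 (1 - norm x / \<epsilon>)" 1 c] by (simp add: G_def)
  qed
  obtain r where r: "r > 0" "\<And>x. norm x > r \<Longrightarrow> J x = 0"
    using ccs_support[OF ccs] by blast
  define R where "R = max r \<epsilon>"
  define H where "H = (\<lambda>a x. J x - (G (x - a) + G (x + a)) / 2)"
  have ccsG: "ccs G"
    unfolding G_def by (rule ccsI[of _ \<epsilon>]) (use G0 \<epsilon> in \<open>auto simp: G_def intro!: continuous_intros\<close>)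
  have Gpos: "(LINT x|lborel. G x) > 0"
  proof (rule ccontr)
    assume "\<not> 0 < (LINT x|lborel. G x)"
    moreover have "(LINT x|lborel. G x) \<ge> 0" using Gc by simp
    ultimately have "(LINT x|lborel. G x) = 0" by linarith
    then have AE: "AE x in lborel. G x = 0"
      using integral_nonneg_eq_0_iff_AE[OF ccs_integrable[OF ccsG]] Gc by auto
    have pos: "G x > 0" if "norm x < \<epsilon>" for x
      using that c \<epsilon>(1) by (simp add: G_def max_def field_simps)
    have imp: "x \<notin> ball 0 \<epsilon>" if "G x = 0" for x
      using pos[of x] that by (cases "norm x < \<epsilon>") auto
    have "AE x in lborel. x \<notin> ball (0::'a) \<epsilon>"
      by (rule AE_mp[OF AE AE_I2]) (intro impI imp)
    then have "ball (0::'a) \<epsilon> \<in> null_sets lborel"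
      by (rule AE_iff_null_sets[THEN iffD2, rotated]) simp
    then have "measure lborel (ball (0::'a) \<epsilon>) = 0"
      by (simp add: measure_eq_0_null_sets)
    moreover have "measure lebesgue (ball (0::'a) \<epsilon>) > 0"
      using content_ball_pos[OF \<epsilon>(1)] by simp
    ultimately show False by simp
  qed
  have "split_kernel J G (H a) a R" if a: "norm (a - a0) \<le> \<epsilon>" for a
  proof
    have GJ: "G (x - a) \<le> J x" for x
    proof (cases "norm (x - a) < \<epsilon>")
      case True
      then have "norm (x - a0) < d" using a \<epsilon>(3) norm_triangle_ineq[of "x - a" "a - a0"] by auto
      then show ?thesis using Jc[of x] Gc[of "x - a"] by linarith
    qed (use G0 nonneg in simp)
    have GJ': "G (x + a) \<le> J x" for x
    proof (cases "norm (x + a) < \<epsilon>")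
      case True
      then have "norm (x + a0) < d" using a \<epsilon>(3) norm_triangle_ineq4[of "x + a" "a - a0"] by auto
      then show ?thesis using Jc'[of x] Gc[of "x + a"] by linarith
    qed (use G0 nonneg in simp)
    show "ccs (H a)"
    proof -
      have "ccs (\<lambda>x. J x - 1 / 2 * (G (x + - a) + G (x + a)))"
        by (intro ccs_diff ccs ccs_cmult ccs_add ccs_shift ccsG)
      then show ?thesis by (simp add: H_def)
    qed
    show "H a x \<ge> 0" for x
      using GJ[of x] GJ'[of x] by (simp add: H_def)
    have Ge: "G (- x) = G x" for x by (simp add: G_def)
    show "G (- x) = G x" for x by (rule Ge)
    show "H a (- x) = H a x" for x
      using Ge[of "x + a"] Ge[of "x - a"] even[of x] by (simp add: H_def)
    show "J x = 0" "G x = 0" if "norm x > R" for x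
      using that r(2)[of x] G0[of x] by (auto simp: R_def)
    then show "H a x = 0" if "norm x > R" for x
      using that GJ[of x] GJ'[of x] Gc[of "x - a"] Gc[of "x + a"] by (force simp: H_def)
    show "R \<ge> 0" using r by (simp add: R_def)
    show "J x = (G (x - a) + G (x + a)) / 2 + H a x" for x
      by (simp add: H_def)
  qed (use ccs ccsG nonneg Gc int Gpos in auto)
  with a0 \<epsilon> show ?thesis using that by blast
qed

text \<open>The cone has half-angle 60 degrees. It keeps away from directions in which lines are
  nearly tangent to the spheres, since such lines stay in the shell for a length of order sqrt
  \<open>r\<close>.\<close>

definition shell_sector :: "'a::euclidean_space \<Rightarrow> real \<Rightarrow> 'a set" where
  "shell_sector a r = {x. r \<le> norm x \<and> norm x \<le> r + 1 \<and> norm a * norm x / 2 \<le> a \<bullet> x}"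

lemma shell_sector_sets [measurable]: "shell_sector a r \<in> sets borel"
proof -
  have "closed (shell_sector a r)"
    unfolding shell_sector_def by (intro closed_Collect_conj closed_Collect_le continuous_intros) auto
  then show ?thesis by simp
qed

text \<open>Lines in directions close to \<open>a0\<close> are transversal to the spheres inside the sector.\<close>

lemma shell_sector_step:
  assumes "norm (a - a0) \<le> norm a0 / 4" "a0 \<noteq> 0" "r \<ge> 1"
    and z: "z \<in> shell_sector a0 r" and z': "z + l *\<^sub>R a \<in> shell_sector a0 r" and l: "l \<ge> 0"
  shows "l \<le> 6 / norm a0"
proof -
  have z1: "norm z \<ge> 1" using z assms(3) by (simp add: shell_sector_def)
  have "(a0 - a) \<bullet> z \<le> norm (a0 - a) * norm z" by (rule norm_cauchy_schwarz)
  also have "\<dots> \<le> norm a0 / 4 * norm z"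
    using assms(1) by (intro mult_right_mono) (auto simp: norm_minus_commute)
  \<comment> \<open>The cone contributes 1/2 and the tilt of \<open>a\<close> costs 1/4. Hence the
    squared norm grows in \<open>l\<close> at rate at least half the product of the norms of
    \<open>a0\<close> and \<open>z\<close>, while the shell leaves room for only three times the
    norm of \<open>z\<close>.\<close>
  finally have "a \<bullet> z \<ge> norm a0 * norm z / 4"
    using z by (simp add: shell_sector_def inner_diff_left)
  then have "l * (norm a0 * norm z / 4) \<le> l * (a \<bullet> z)"
    using l by (rule mult_left_mono)
  moreover have "norm (z + l *\<^sub>R a) ^ 2 = norm z ^ 2 + 2 * (l * (a \<bullet> z)) + l ^ 2 * norm a ^ 2"
    unfolding power2_norm_eq_inner by (simp add: inner_simps inner_commute power2_eq_square)
  moreover have "norm (z + l *\<^sub>R a) ^ 2 \<le> (norm z + 1) ^ 2"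
    using z z' by (intro power_mono) (auto simp: shell_sector_def)
  moreover have "0 \<le> l ^ 2 * norm a ^ 2" by simp
  moreover have "(norm z + 1) ^ 2 \<le> norm z ^ 2 + 3 * norm z"
    using z1 by (simp add: power2_eq_square algebra_simps)
  ultimately have "2 * (l * (norm a0 * norm z / 4)) \<le> 3 * norm z"
    by linarith
  then have "l * norm a0 * norm z \<le> 6 * norm z" by (simp add: field_simps)
  then have "l * norm a0 \<le> 6" by (rule mult_right_le_imp_le) (use z1 in linarith)
  then show ?thesis using assms(2) by (simp add: field_simps)
qed

lemma shell_sector_overlap:
  assumes "norm (a - a0) \<le> norm a0 / 4" "a0 \<noteq> 0" "r \<ge> 1"
  shows "finite {m::int. y + of_int m *\<^sub>R a \<in> shell_sector a0 r}"
    and "real (card {m::int. y + of_int m *\<^sub>R a \<in> shell_sector a0 r}) \<le> 12 / norm a0 + 1"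
proof -
  let ?M = "{m::int. y + of_int m *\<^sub>R a \<in> shell_sector a0 r}"
  define L where "L = \<lfloor>6 / norm a0\<rfloor>"
  have L0: "L \<ge> 0" by (simp add: L_def)
  have "finite ?M \<and> real (card ?M) \<le> 12 / norm a0 + 1"
  proof (cases "?M = {}")
    case False
    then obtain m0 where m0: "m0 \<in> ?M" by blast
    have le: "m' - m \<le> L" if "m \<in> ?M" "m' \<in> ?M" "m \<le> m'" for m m'
    proof -
      have e: "y + of_int m *\<^sub>R a + (of_int m' - of_int m) *\<^sub>R a = y + of_int m' *\<^sub>R a"
        by (simp only: scaleR_diff_left) simp
      have "y + of_int m *\<^sub>R a + (of_int m' - of_int m) *\<^sub>R a \<in> shell_sector a0 r"
        unfolding e using that by simp
      then have "real_of_int m' - of_int m \<le> 6 / norm a0"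
        using shell_sector_step[OF assms, of "y + of_int m *\<^sub>R a" "of_int m' - of_int m"] that by simp
      then have "real_of_int (m' - m) \<le> 6 / norm a0" by simp
      then show ?thesis unfolding L_def by (simp only: le_floor_iff)
    qed
    have sub: "?M \<subseteq> {m0 - L..m0 + L}"
    proof
      fix m assume "m \<in> ?M"
      then show "m \<in> {m0 - L..m0 + L}"
        using le[of m m0] le[of m0 m] m0 L0 by (cases "m \<le> m0") auto
    qed
    have "card ?M \<le> card {m0 - L..m0 + L}" by (rule card_mono[OF _ sub]) simp
    then have "real (card ?M) \<le> 2 * of_int L + 1" using L0 by (simp add: of_nat_nat)
    also have "\<dots> \<le> 12 / norm a0 + 1"
      using of_int_floor_le[of "6 / norm a0"] unfolding L_def by linarith
    finally show ?thesis using finite_subset[OF sub] by simp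
  next
    case True
    then show ?thesis unfolding True by simp
  qed
  then show "finite ?M" "real (card ?M) \<le> 12 / norm a0 + 1" by auto
qed

text \<open>Steps \<open>2 *\<^sub>R a\<close> with \<open>a\<close> near \<open>a0\<close> are
  controlled directly (\<open>F_base\<close>). Two of them, in opposite directions, compose to a
  short step (\<open>F_step\<close>), and a bounded number of short steps along a segment reaches
  any \<open>w\<close> in the ball (\<open>chain\<close>).\<close>

lemma conv_power_shell_increment:
  fixes J :: "'a::euclidean_space \<Rightarrow> real"
  assumes ccs: "ccs J" and nonneg: "\<And>x. J x \<ge> 0" and even: "\<And>x. J (- x) = J x"
    and int: "(LINT x|lborel. J x) = 1" and \<rho>: "\<rho> > 0"
  obtains a0 C r0 where "a0 \<noteq> 0" "C > 0" "r0 \<ge> 1"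
    "\<And>r k w. r \<ge> r0 \<Longrightarrow> norm w \<le> \<rho> \<Longrightarrow>
      (LINT x|lborel. indicator (shell_sector a0 r) x * \<bar>conv_power J k (x + w) - conv_power J k x\<bar>)
        \<le> C * (real k + 1) / r ^ 4"
proof -
  obtain a0 \<epsilon> R G H where a0: "a0 \<noteq> 0" and \<epsilon>: "\<epsilon> > 0" "\<epsilon> \<le> norm a0 / 4"
    and split: "\<And>a. norm (a - a0) \<le> \<epsilon> \<Longrightarrow> split_kernel J G (H a) a R"
    using kernel_splitting[OF ccs nonneg even int] by metis
  define K where "K = 12 / norm a0 + 1"
  define pG where "pG = (LINT x|lborel. G x)"
  \<comment> \<open>Twice the norm of \<open>a0\<close> replaces the norm of \<open>a\<close>, so
    that the constant is uniform in \<open>a\<close>.\<close>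
  define C1 where "C1 = 2 * K * (96 * R ^ 4 + 1536 * (2 * norm a0) ^ 4) / pG"
  have pG: "pG > 0"
    using split_kernel.G_integral[OF split[of a0]] \<epsilon>(1) by (simp add: pG_def)
  have K: "K > 0" using a0 by (simp add: K_def add_pos_pos)
  have C1: "C1 > 0" unfolding C1_def using a0 pG K by (intro divide_pos_pos mult_pos_pos add_nonneg_pos) auto
  \<comment> \<open>Bounds every midpoint by which the sector will be translated;
    \<open>r \<ge> 2 * V\<close> then keeps the translated sector at distance at least r/2 from the
    origin, whence the factor 16 below.\<close>
  define V where "V = \<rho> + 4 * norm a0"
  define r0 where "r0 = max 1 (2 * V)"
  define F where "F = (\<lambda>r k v w. LINT x|lborel. indicator (shell_sector a0 r) x *
      \<bar>conv_power J k (x + v) - conv_power J k (x + w)\<bar>)"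
  have iF: "integrable lborel (\<lambda>x. indicator S x * \<bar>conv_power J k (x + v) - conv_power J k (x + w)\<bar>)"
    if "S \<in> sets borel" for S k v w
    using integrable_abs[OF integrable_indicator_ccs[OF _ that, of
        "\<lambda>x. conv_power J k (x + v) - conv_power J k (x + w)"]]
    by (simp add: abs_mult ccs_diff ccs_shift ccs_conv_power ccs)
  have F_tri: "F r k v z \<le> F r k v w + F r k w z" for r k v w z
    unfolding F_def Bochner_Integration.integral_add[OF iF iF, OF shell_sector_sets shell_sector_sets, symmetric]
  proof (rule integral_mono)
    show "indicator (shell_sector a0 r) x * \<bar>conv_power J k (x + v) - conv_power J k (x + z)\<bar>
        \<le> indicator (shell_sector a0 r) x * \<bar>conv_power J k (x + v) - conv_power J k (x + w)\<bar>
          + indicator (shell_sector a0 r) x * \<bar>conv_power J k (x + w) - conv_power J k (x + z)\<bar>" for x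
      by (auto simp: indicator_def)
  qed (intro iF Bochner_Integration.integrable_add shell_sector_sets)+
  have F_sym: "F r k v w = F r k w v" for r k v w
    unfolding F_def by (simp add: abs_minus_commute)
  have F_base: "F r k v (v + 2 *\<^sub>R a) \<le> 16 * C1 * (real k + 1) / r ^ 4"
    if a: "norm (a - a0) \<le> \<epsilon>" and r: "r \<ge> r0" and v: "norm (v + a) \<le> V" for r k v a
  proof -
    interpret split_kernel J G "H a" a R by (rule split[OF a])
    let ?w = "v + a"
    \<comment> \<open>Centring at the midpoint \<open>v + a\<close> makes the increment symmetric,
      at the price of translating the sector; the overlap count is unaffected.\<close>
    let ?S = "{x. x - ?w \<in> shell_sector a0 r}"
    have r1: "r \<ge> 1" "r \<ge> 2 * V" using r by (auto simp: r0_def)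
    have a4: "norm (a - a0) \<le> norm a0 / 4" using a \<epsilon> by linarith
    have na: "norm a \<le> 2 * norm a0" using a4 norm_triangle_sub[of a a0] norm_ge_zero[of a0] by linarith
    have S: "?S \<in> sets borel" by measurable
    have ov: "finite {m::int. y + of_int m *\<^sub>R a \<in> ?S}" "real (card {m::int. y + of_int m *\<^sub>R a \<in> ?S}) \<le> K" for y
      using shell_sector_overlap[OF a4 a0 r1(1), of "y - ?w"] by (auto simp: K_def algebra_simps)
    let ?h = "\<lambda>x. indicator ?S x * \<bar>conv_power J k (x - a) - conv_power J k (x + a)\<bar>"
    have hi: "integrable lborel ?h" using iF[OF S, of k "- a" a] by simp
    have "F r k v (v + 2 *\<^sub>R a) = (LINT x|lborel. ?h (x + ?w))"
      unfolding F_def by (simp add: indicator_def scaleR_2 algebra_simps)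
    also have "\<dots> = (LINT x|lborel. ?h x)"
      by (rule lborel_integral_shift) (use borel_measurable_integrable[OF hi] in simp)
    also have "\<dots> \<le> (LINT x|lborel. 16 / r ^ 4 *
        (indicator ?S x * norm x ^ 4 * \<bar>conv_power J k (x - a) - conv_power J k (x + a)\<bar>))"
    proof (rule integral_mono[OF hi])
      have "ccs (\<lambda>x. norm x ^ 4 * (conv_power J k (x + - a) - conv_power J k (x + a)))"
        by (intro ccs_mult ccs_diff ccs_shift ccs_conv_power ccs continuous_intros)
      from integrable_abs[OF integrable_indicator_ccs[OF this S]]
      show "integrable lborel (\<lambda>x. 16 / r ^ 4 *
          (indicator ?S x * norm x ^ 4 * \<bar>conv_power J k (x - a) - conv_power J k (x + a)\<bar>))"
        by (simp add: abs_mult mult.assoc)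
      fix x
      have "1 \<le> 16 / r ^ 4 * norm x ^ 4" if "x \<in> ?S"
      proof -
        have "r \<le> norm (x - ?w)" using that by (simp add: shell_sector_def)
        then have "r / 2 \<le> norm x" using norm_triangle_ineq4[of x ?w] v r1 by linarith
        then have "(r / 2) ^ 4 \<le> norm x ^ 4" using r1 by (intro power_mono) auto
        then show ?thesis using r1 by (simp add: field_simps)
      qed
      then show "?h x \<le> 16 / r ^ 4 *
          (indicator ?S x * norm x ^ 4 * \<bar>conv_power J k (x - a) - conv_power J k (x + a)\<bar>)"
        using mult_right_mono[of 1 "16 / r ^ 4 * norm x ^ 4" "\<bar>conv_power J k (x - a) - conv_power J k (x + a)\<bar>"]
        by (cases "x \<in> ?S") (auto simp: mult.assoc)
    qed
    also have "\<dots> = 16 / r ^ 4 * (LINT x|lborel.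
        (indicator ?S x * norm x ^ 4 * \<bar>conv_power J k (x - a) - conv_power J k (x + a)\<bar>))"
      by (rule integral_mult_right_zero)
    also have "\<dots> \<le> 16 / r ^ 4 * (2 * K * (96 * R ^ 4 + 1536 * norm a ^ 4) / pG * (real k + 1))"
      using r1 conv_power_diff_integral_le[OF S ov, of k] by (intro mult_left_mono) (auto simp: pG_def p_def)
    also have "\<dots> \<le> 16 / r ^ 4 * (C1 * (real k + 1))"
      unfolding C1_def using r1 pG K na
      by (intro mult_left_mono mult_right_mono divide_right_mono add_mono power_mono) auto
    finally show ?thesis by (simp add: algebra_simps)
  qed
  have F_step: "F r k v (v + w) \<le> 32 * C1 * (real k + 1) / r ^ 4"
    if w: "norm w \<le> 2 * \<epsilon>" and r: "r \<ge> r0" and v: "norm v \<le> \<rho>" for r k v w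
  proof -
    define a where "a = a0 + (1 / 2) *\<^sub>R w"
    have a: "norm (a - a0) \<le> \<epsilon>" using w by (simp add: a_def)
    have "norm (v + a) \<le> norm v + norm a0 + norm w / 2"
      unfolding a_def using norm_triangle_ineq[of v a] norm_triangle_ineq[of a0 "(1 / 2) *\<^sub>R w"]
      by (simp add: a_def)
    then have 1: "norm (v + a) \<le> V" using v w \<epsilon>(2) norm_ge_zero[of a0] unfolding V_def by linarith
    have "norm (v + w + a0) \<le> norm v + norm a0 + norm w"
      using norm_triangle_ineq[of "v + w" a0] norm_triangle_ineq[of v w] by linarith
    then have 2: "norm (v + w + a0) \<le> V" using v w \<epsilon>(2) norm_ge_zero[of a0] unfolding V_def by linarith
    \<comment> \<open>The route from \<open>v\<close> to \<open>v + w\<close> goes out by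
      \<open>2 *\<^sub>R a\<close> and comes back by \<open>2 *\<^sub>R a0\<close>.\<close>
    have e: "v + 2 *\<^sub>R a = v + w + 2 *\<^sub>R a0" by (simp add: a_def algebra_simps)
    have "F r k v (v + w) \<le> F r k v (v + 2 *\<^sub>R a) + F r k (v + w) (v + w + 2 *\<^sub>R a0)"
      using F_tri[of r k v "v + w" "v + 2 *\<^sub>R a"] F_sym e by metis
    also have "\<dots> \<le> 16 * C1 * (real k + 1) / r ^ 4 + 16 * C1 * (real k + 1) / r ^ 4"
      using \<epsilon> by (intro add_mono F_base a r 1 2) auto
    finally show ?thesis by simp
  qed
  define n where "n = Suc (nat \<lceil>\<rho> / (2 * \<epsilon>)\<rceil>)"
  have n: "\<rho> \<le> 2 * \<epsilon> * real n" "n > 0"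
  proof -
    have "\<rho> / (2 * \<epsilon>) \<le> real n" unfolding n_def using real_nat_ceiling_ge[of "\<rho> / (2 * \<epsilon>)"] by simp
    then show "\<rho> \<le> 2 * \<epsilon> * real n" using \<epsilon>(1) by (simp add: field_simps)
  qed (simp add: n_def)
  have chain: "F r k 0 ((real i / real n) *\<^sub>R w) \<le> real i * (32 * C1 * (real k + 1) / r ^ 4)"
    if w: "norm w \<le> \<rho>" and r: "r \<ge> r0" and i: "i \<le> n" for r k w i
    using i
  proof (induction i)
    case 0
    then show ?case by (simp add: F_def)
  next
    case (Suc i)
    let ?v = "(real i / real n) *\<^sub>R w" and ?u = "(1 / real n) *\<^sub>R w"
    have e: "(real (Suc i) / real n) *\<^sub>R w = ?v + ?u"
      by (simp add: scaleR_add_left[symmetric] add_divide_distrib add.commute)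
    have "real i / real n \<le> 1" using Suc by simp
    then have "real i / real n * norm w \<le> 1 * \<rho>" using w by (intro mult_mono) auto
    then have v: "norm ?v \<le> \<rho>" by simp
    have u: "norm ?u \<le> 2 * \<epsilon>" using w n by (simp add: field_simps)
    have "F r k 0 (?v + ?u) \<le> F r k 0 ?v + F r k ?v (?v + ?u)" by (rule F_tri)
    also have "\<dots> \<le> real i * (32 * C1 * (real k + 1) / r ^ 4) + 1 * (32 * C1 * (real k + 1) / r ^ 4)"
      using Suc F_step[OF u r v] by (intro add_mono) auto
    finally show ?case unfolding e distrib_right[symmetric] by (simp add: add.commute)
  qed
  show ?thesis
  proof (rule that[of a0 "real n * (32 * C1)" r0])
    show "(LINT x|lborel. indicator (shell_sector a0 r) x * \<bar>conv_power J k (x + w) - conv_power J k x\<bar>)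
        \<le> real n * (32 * C1) * (real k + 1) / r ^ 4" if "r \<ge> r0" "norm w \<le> \<rho>" for r k w
      using chain[OF that(2,1), of n k] n F_sym[of r k 0 w] by (simp add: F_def mult.assoc)
  qed (use a0 C1 n in \<open>auto simp: r0_def\<close>)
qed

subsection \<open>Radial kernels\<close>

text \<open>For \<open>e = 0\<close> this is the identity, since \<open>x / 0 = 0\<close>.\<close>

definition reflect :: "'a::euclidean_space \<Rightarrow> 'a \<Rightarrow> 'a" where
  "reflect e x = x - (2 * (x \<bullet> e) / (e \<bullet> e)) *\<^sub>R e"

lemma reflect_add: "reflect e (x + y) = reflect e x + reflect e y"
  by (simp add: reflect_def inner_add_left add_divide_distrib distrib_left algebra_simps)

lemma reflect_scaleR: "reflect e (c *\<^sub>R x) = c *\<^sub>R reflect e x"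
  by (simp add: reflect_def algebra_simps)

lemma reflect_diff: "reflect e (x - y) = reflect e x - reflect e y"
  using reflect_add[of e x "- 1 *\<^sub>R y"] unfolding reflect_scaleR by simp

lemma reflect_reflect [simp]: "reflect e (reflect e x) = x"
proof (cases "e = 0")
  case False
  then have "reflect e x \<bullet> e = - (x \<bullet> e)"
    by (simp add: reflect_def inner_diff_left)
  then show ?thesis by (simp add: reflect_def[of e "reflect e x"]) (simp add: reflect_def)
qed (simp add: reflect_def)

lemma norm_reflect [simp]: "norm (reflect e x) = norm x"
proof (cases "e = 0")
  case False
  then have "reflect e x \<bullet> reflect e x = x \<bullet> x"
    by (simp add: reflect_def inner_diff_left inner_diff_right inner_commute field_simps)
  then show ?thesis by (simp add: norm_eq_sqrt_inner)
qed (simp add: reflect_def)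

lemma reflect_swap:
  assumes "norm a = norm b"
  shows "reflect (a - b) a = b"
proof (cases "a = b")
  case False
  have "a \<bullet> a = b \<bullet> b" using assms by (simp add: norm_eq_sqrt_inner)
  then have "(a - b) \<bullet> (a - b) = 2 * (a \<bullet> (a - b))"
    by (simp add: inner_diff_left inner_diff_right inner_commute)
  moreover have "(a - b) \<bullet> (a - b) \<noteq> 0" using False by simp
  ultimately show ?thesis by (simp add: reflect_def)
qed (simp add: reflect_def)

lemma continuous_reflect: "continuous_on S (reflect e)"
  unfolding reflect_def by (cases "e = 0") (auto intro!: continuous_intros)

text \<open>Uniqueness of Haar measure, applied to \<open>f \<mapsto> \<integral>f (reflect e x) dx\<close>: comparing with a radial
  bump function shows that the constant is 1.\<close>

lemma integral_reflect:
  fixes f :: "'a::euclidean_space \<Rightarrow> real"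
  assumes "ccs f"
  shows "(LINT x|lborel. f (reflect e x)) = (LINT x|lborel. f x)"
proof -
  let ?T = "reflect e"
  define g where "g = (\<lambda>x::'a. max 0 (1 - norm x))"
  have g0: "g x = 0" if "norm x > 1" for x using that by (simp add: g_def)
  have cg: "ccs g"
    by (rule ccsI[of _ 1]) (auto simp: g_def intro!: continuous_intros)
  have gT: "g (?T x) = g x" for x by (simp add: g_def)
  have gi: "(LINT x|lborel. g x) \<noteq> 0"
  proof
    assume "(LINT x|lborel. g x) = 0"
    then have "AE x in lborel. g x = 0"
      using integral_nonneg_eq_0_iff_AE[OF ccs_integrable[OF cg]] by (auto simp: g_def)
    then have "AE x in lborel. x \<notin> ball (0::'a) 1"
      by (rule AE_mp) (auto simp: g_def)
    then have "ball (0::'a) 1 \<in> null_sets lborel"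
      by (rule AE_iff_null_sets[THEN iffD2, rotated]) simp
    then have "measure lborel (ball (0::'a) 1) = 0"
      by (simp add: measure_eq_0_null_sets)
    then show False using content_ball_pos[of 1 "0::'a"] by simp
  qed
  obtain r where r: "r > 0" "\<And>x. norm x > r \<Longrightarrow> f x = 0"
    using ccs_support[OF assms] by blast
  have [measurable]: "f \<in> borel_measurable borel" "g \<in> borel_measurable borel"
    using assms cg by (auto intro: ccs_measurable)
  have mT [measurable]: "?T \<in> borel_measurable borel"
    by (intro borel_measurable_continuous_onI continuous_reflect)
  obtain Bf where Bf: "Bf > 0" "\<And>x. \<bar>f x\<bar> \<le> Bf" using ccs_bounded[OF assms] by blast
  have gB: "\<bar>g x\<bar> \<le> 1" for x by (simp add: g_def)
  \<comment> \<open>The Haar argument: integrating in \<open>y\<close> first gives the reflected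
    integral of \<open>f\<close> times the integral of \<open>g\<close>; integrating in
    \<open>x\<close> first allows a translation that exchanges the roles of \<open>f\<close> and
    \<open>g\<close>.\<close>
  let ?F = "\<lambda>x y. f (?T x) * g (y + ?T x)"
  have F0: "?F x y = 0" if "norm x > r + 1 \<or> norm y > r + 1" for x y
  proof (cases "norm x > r")
    case False
    then have "norm (y + ?T x) > 1"
      using that norm_triangle_ineq4[of "y + ?T x" "?T x"] by auto
    then show ?thesis using g0 by simp
  qed (use r in simp)
  have "(LINT x|lborel. f (?T x)) * (LINT y|lborel. g y) = (LINT x|lborel. f (?T x) * (LINT y|lborel. g (y + ?T x)))"
    by (simp add: lborel_integral_shift)
  also have "\<dots> = (LINT x|lborel. LINT y|lborel. ?F x y)"
    by simp
  also have "\<dots> = (LINT y|lborel. LINT x|lborel. ?F x y)"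
  proof (rule lborel_Fubini_bounded(1)[OF _ _ F0])
    show "case_prod ?F \<in> borel_measurable borel"
      unfolding borel_prod[symmetric] by measurable
    show "\<bar>?F x y\<bar> \<le> Bf * 1" for x y
      unfolding abs_mult using Bf gB by (intro mult_mono) auto
  qed auto
  also have "\<dots> = (LINT y|lborel. LINT x|lborel. f (?T x - y) * g (?T x))"
  proof -
    have "(LINT x|lborel. ?F x y) = (LINT x|lborel. f (?T x - y) * g (?T x))" for y
    proof -
      \<comment> \<open>As \<open>reflect e\<close> is additive and an involution, it sends
        \<open>x - ?T y\<close> to \<open>?T x - y\<close>, which removes the shift from the
        argument of \<open>g\<close>.\<close>
      have "(LINT x|lborel. ?F (x + - ?T y) y) = (LINT x|lborel. ?F x y)"
        by (rule lborel_integral_shift) measurable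
      then show ?thesis by (simp add: reflect_diff)
    qed
    then show ?thesis by simp
  qed
  also have "\<dots> = (LINT x|lborel. LINT y|lborel. f (?T x - y) * g (?T x))"
  proof (rule lborel_Fubini_bounded(1)[where r = "r + 1" and B = "Bf * 1"])
    show "(\<lambda>(y, x). f (?T x - y) * g (?T x)) \<in> borel_measurable borel"
      unfolding borel_prod[symmetric] by measurable
    show "\<bar>f (?T x - y) * g (?T x)\<bar> \<le> Bf * 1" for x y
      unfolding abs_mult using Bf gB by (intro mult_mono) auto
    show "f (?T x - y) * g (?T x) = 0" if "r + 1 < norm y \<or> r + 1 < norm x" for x y
    proof (cases "norm x > 1")
      case False
      then have "norm (?T x - y) > r"
        using that r(1) norm_triangle_ineq4[of "?T x" "?T x - y"] by auto
      then show ?thesis using r by simp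
    qed (use g0 in simp)
  qed
  also have "\<dots> = (LINT x|lborel. g x) * (LINT y|lborel. f y)"
    using lborel_integral_flip[of f "?T x" for x] gT by simp
  finally show ?thesis using gi by simp
qed

text \<open>The full orthogonal group can be avoided: for points of equal norm, the reflection in
  their perpendicular bisector carries one to the other.\<close>

lemma radially_symmetric_conv:
  fixes f g :: "'a::euclidean_space \<Rightarrow> real"
  assumes "ccs f" "ccs g" "radially_symmetric f" "radially_symmetric g"
  shows "radially_symmetric (conv f g)"
  unfolding radially_symmetric_def
proof (intro allI impI)
  fix x y :: 'a assume xy: "norm x = norm y"
  let ?T = "reflect (x - y)"
  have inv: "h (?T z) = h z" if "radially_symmetric h" for h :: "'a \<Rightarrow> real" and z
    using that norm_reflect[of "x - y" z] unfolding radially_symmetric_def by blast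
  have "ccs (\<lambda>z. f (y - z) * g z)"
    using ccs_mult[OF ccs_continuous[OF ccs_flip[OF assms(1)]] assms(2)] .
  then have "conv f g y = (LINT z|lborel. f (y - ?T z) * g (?T z))"
    unfolding conv_def by (rule integral_reflect[symmetric])
  also have "\<dots> = (LINT z|lborel. f (x - z) * g z)"
  proof (intro Bochner_Integration.integral_cong refl)
    fix z
    have "f (y - ?T z) = f (?T (x - z))" by (simp add: reflect_diff reflect_swap[OF xy])
    then show "f (y - ?T z) * g (?T z) = f (x - z) * g z" by (simp add: inv assms)
  qed
  finally show "conv f g x = conv f g y" by (simp add: conv_def)
qed

lemma radially_symmetric_conv_power:
  "ccs J \<Longrightarrow> radially_symmetric J \<Longrightarrow> radially_symmetric (conv_power J k)"
  by (induction k) (auto intro: radially_symmetric_conv ccs_conv_power)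

text \<open>The cone truncated at radius \<rho> has volume proportional to \<rho>^N. The sector
  covers the difference of two truncations, and (r+1)^N - r^N \<ge> r^(N-1).\<close>

lemma measure_shell_sector_ge:
  fixes a :: "'a::euclidean_space"
  assumes "a \<noteq> 0"
  obtains v where "v > 0" "\<And>r. r > 0 \<Longrightarrow> v * r ^ (DIM('a) - 1) \<le> measure lborel (shell_sector a r)"
proof -
  define S where "S = (\<lambda>\<rho>. {x. norm x \<le> \<rho> \<and> norm a * norm x / 2 \<le> a \<bullet> x})"
  define v where "v = measure lborel (S 1)"
  have closed: "closed (S \<rho>)" for \<rho>
    unfolding S_def by (intro closed_Collect_conj closed_Collect_le continuous_intros) auto
  have bnd: "bounded (S \<rho>)" for \<rho>
    by (rule bounded_subset[of "cball 0 \<rho>"]) (auto simp: S_def)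
  have fin: "S \<rho> \<in> fmeasurable lborel" for \<rho>
    using closed emeasure_bounded_finite[OF bnd] by (intro fmeasurableI) auto
  have scale: "measure lborel (S \<rho>) = \<rho> ^ DIM('a) * v" if "\<rho> > 0" for \<rho>
  proof -
    have "S \<rho> = (\<lambda>x. \<rho> *\<^sub>R x + 0) ` S 1"
    proof (intro set_eqI iffI)
      fix x assume "x \<in> S \<rho>"
      then have "(1 / \<rho>) *\<^sub>R x \<in> S 1"
        using that by (auto simp: S_def field_simps)
      then show "x \<in> (\<lambda>x. \<rho> *\<^sub>R x + 0) ` S 1"
        using that by (intro image_eqI[of _ _ "(1 / \<rho>) *\<^sub>R x"]) auto
    next
      fix x assume "x \<in> (\<lambda>x. \<rho> *\<^sub>R x + 0) ` S 1"
      then obtain y where y: "x = \<rho> *\<^sub>R y" "norm y \<le> 1" "norm a * norm y / 2 \<le> a \<bullet> y" by (auto simp: S_def)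
      have "\<rho> * (norm a * norm y / 2) \<le> \<rho> * (a \<bullet> y)" using y that by (intro mult_left_mono) auto
      then show "x \<in> S \<rho>" using y that by (auto simp: S_def mult_ac)
    qed
    then have "measure lebesgue (S \<rho>) = \<rho> ^ DIM('a) * measure lebesgue (S 1)"
      using measure_lebesgue_affine[of \<rho> 0 "S 1"] that by simp
    then show ?thesis using closed by (simp add: v_def)
  qed
  have v: "v > 0"
  proof -
    \<comment> \<open>For unit \<open>a\<close>, points of this ball have norm at most 5/8 and inner
      product with \<open>a\<close> at least 3/8, more than the required 5/16.\<close>
    have "ball ((1 / (2 * norm a)) *\<^sub>R a) (1 / 8) \<subseteq> S 1"
    proof
      fix x assume "x \<in> ball ((1 / (2 * norm a)) *\<^sub>R a) (1 / 8)"
      define d where "d = x - (1 / (2 * norm a)) *\<^sub>R a"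
      have d: "norm d < 1 / 8"
        using \<open>x \<in> _\<close> by (simp add: d_def dist_norm norm_minus_commute)
      have x: "x = (1 / (2 * norm a)) *\<^sub>R a + d" by (simp add: d_def)
      have n: "norm x \<le> 5 / 8"
        unfolding x using norm_triangle_ineq[of "(1 / (2 * norm a)) *\<^sub>R a" d] d assms by simp
      have "- (a \<bullet> d) \<le> norm a * norm d" using norm_cauchy_schwarz[of a "- d"] by simp
      also have "\<dots> \<le> norm a * (1 / 8)" using d by (intro mult_left_mono) auto
      finally have "a \<bullet> d \<ge> - norm a / 8" by simp
      moreover have "a \<bullet> x = norm a / 2 + a \<bullet> d"
        unfolding x using assms by (simp add: inner_add_right power2_norm_eq_inner[symmetric] power2_eq_square)
      moreover have "norm a * norm x \<le> norm a * (5 / 8)" using n by (intro mult_left_mono) auto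
      ultimately have "norm a * norm x / 2 \<le> a \<bullet> x"
        using norm_ge_zero[of a] by linarith
      then show "x \<in> S 1" using n by (simp add: S_def)
    qed
    then have "measure lborel (ball ((1 / (2 * norm a)) *\<^sub>R a) (1 / 8)) \<le> v"
      unfolding v_def by (intro measure_mono_fmeasurable fin) auto
    moreover have "0 < measure lborel (ball ((1 / (2 * norm a)) *\<^sub>R a) (1 / 8))"
      by (rule content_ball_pos) simp
    ultimately show ?thesis by linarith
  qed
  have "v * r ^ (DIM('a) - 1) \<le> measure lborel (shell_sector a r)" if r: "r > 0" for r
  proof -
    have "bounded (shell_sector a r)"
      by (rule bounded_subset[of "cball 0 (r + 1)"]) (auto simp: shell_sector_def)
    from emeasure_bounded_finite[OF this] have fs: "shell_sector a r \<in> fmeasurable lborel"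
      by (intro fmeasurableI) auto
    have "measure lborel (S (r + 1)) \<le> measure lborel (S r \<union> shell_sector a r)"
      by (intro measure_mono_fmeasurable fmeasurable.Un fin fs) (use closed in \<open>auto simp: S_def shell_sector_def\<close>)
    also have "\<dots> \<le> measure lborel (S r) + measure lborel (shell_sector a r)"
      by (intro measure_Un_le fmeasurableD fin fs)
    finally have "((r + 1) ^ DIM('a) - r ^ DIM('a)) * v \<le> measure lborel (shell_sector a r)"
      using r by (simp add: scale algebra_simps)
    moreover obtain m where m: "DIM('a) = Suc m" using DIM_positive[where 'a = 'a] gr0_implies_Suc by blast
    have "(r + 1) * r ^ m \<le> (r + 1) * (r + 1) ^ m" using r by (intro mult_left_mono power_mono) auto
    then have "r ^ m * v \<le> ((r + 1) ^ DIM('a) - r ^ DIM('a)) * v"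
      using v by (intro mult_right_mono) (auto simp: m algebra_simps)
    ultimately show ?thesis by (simp add: m mult.commute)
  qed
  with v show ?thesis using that by blast
qed

text \<open>Convolving with a probability density preserves the Lipschitz constant. The bound,
  uniform in \<open>k\<close>, takes care of bounded \<open>x\<close>.\<close>

lemma conv_power_Lipschitz:
  assumes ccs: "ccs J" and nonneg: "\<And>x. J x \<ge> 0" and int: "(LINT x|lborel. J x) = 1"
    and lip: "\<And>x y. \<bar>J x - J y\<bar> \<le> L * norm (x - y)"
  shows "\<bar>conv_power J k x - conv_power J k y\<bar> \<le> L * norm (x - y)"
proof (cases k)
  case 0
  then show ?thesis using lip by simp
next
  case (Suc i)
  let ?u = "conv_power J i"
  have u: "ccs ?u" "integrable lborel ?u" "\<And>x. ?u x \<ge> 0" "(LINT x|lborel. ?u x) = 1"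
    using ccs nonneg int by (auto intro: ccs_conv_power ccs_integrable conv_power_nonneg integral_conv_power)
  have i: "integrable lborel (\<lambda>z. J (x - z) * ?u z)" for x
    by (intro conv_integrable ccs ccs_continuous u)
  have "\<bar>conv J ?u x - conv J ?u y\<bar> = \<bar>LINT z|lborel. (J (x - z) - J (y - z)) * ?u z\<bar>"
    unfolding conv_def left_diff_distrib using i by simp
  also have "\<dots> \<le> (LINT z|lborel. \<bar>(J (x - z) - J (y - z)) * ?u z\<bar>)"
    by (rule integral_abs_bound)
  also have "\<dots> \<le> (LINT z|lborel. L * norm (x - y) * ?u z)"
  proof (rule integral_mono)
    show "integrable lborel (\<lambda>z. \<bar>(J (x - z) - J (y - z)) * ?u z\<bar>)"
      unfolding left_diff_distrib by (intro integrable_abs Bochner_Integration.integrable_diff i)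
    show "\<bar>(J (x - z) - J (y - z)) * ?u z\<bar> \<le> L * norm (x - y) * ?u z" for z
      using lip[of "x - z" "y - z"] u(3)[of z] by (simp add: abs_mult mult_right_mono)
  qed (use u in auto)
  also have "\<dots> = L * norm (x - y)" using u by simp
  finally show ?thesis by (simp add: Suc)
qed

text \<open>Radiality moves the increment at \<open>x\<close> to the point \<open>y\<close> of the
  same norm on the ray through \<open>z\<close>, which is within distance 1 of \<open>z\<close>. The
  left side does not depend on \<open>z\<close>, so the bound can then be averaged over the
  sector.\<close>

lemma conv_power_increment_shell:
  fixes J :: "'a::euclidean_space \<Rightarrow> real"
  assumes ccs: "ccs J" and int: "(LINT x|lborel. J x) = 1"
    and rad: "radially_symmetric J" and lip: "\<And>x y. \<bar>J x - J y\<bar> \<le> L * norm (x - y)"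
    and supp: "\<And>x. norm x > R \<Longrightarrow> J x = 0" and u: "ccs u" "radially_symmetric u"
    and x: "norm x > 0" and h: "norm h \<le> 1" and z: "norm x \<le> norm z" "norm z \<le> norm x + 1"
  shows "\<bar>conv J u (x + h) - conv J u x\<bar>
    \<le> L * norm h * (LINT w|lborel. indicator (cball 0 (R + 2)) w * \<bar>u (z + w) - u z\<bar>)"
proof -
  define y where "y = (norm x / norm z) *\<^sub>R z"
  have "z \<noteq> 0" using x z by auto
  then have ny: "norm y = norm x" by (simp add: y_def)
  define k where "k = reflect (x - y) h"
  have nk: "norm k = norm h" by (simp add: k_def)
  have "reflect (x - y) (x + h) = y + k"
    by (simp add: reflect_add k_def reflect_swap[OF ny[symmetric]])
  then have nyk: "norm (x + h) = norm (y + k)" by (metis norm_reflect)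
  have yz: "norm (y - z) \<le> 1"
  proof -
    have "y - z = (norm x / norm z - 1) *\<^sub>R z" by (simp add: y_def scaleR_diff_left)
    then have "norm (y - z) = \<bar>(norm x / norm z - 1) * norm z\<bar>" by (simp add: abs_mult)
    also have "(norm x / norm z - 1) * norm z = norm x - norm z"
      using \<open>z \<noteq> 0\<close> by (simp add: left_diff_distrib)
    finally show ?thesis using z by simp
  qed
  have "radially_symmetric (conv J u)"
    by (intro radially_symmetric_conv ccs rad u)
  then have e: "conv J u (x + h) - conv J u x = conv J u (y + k) - conv J u y"
    using nyk ny unfolding radially_symmetric_def by metis
  have Ji: "(LINT s|lborel. J (c - s)) = 1" "integrable lborel (\<lambda>s. J (c - s))" for c
    using lborel_integral_flip[OF ccs_measurable[OF ccs]] int ccs_integrable[OF ccs_flip[OF ccs]] by simp_all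
  have i: "integrable lborel (\<lambda>s. J (c - s) * u s)" for c
    by (intro conv_integrable ccs ccs_continuous u)
  \<comment> \<open>Both translates of \<open>J\<close> have mass 1, so the constant
    \<open>u z\<close> can be subtracted under the integral; this produces increments of
    \<open>u\<close>.\<close>
  have sub: "conv J u c - u z = (LINT s|lborel. J (c - s) * (u s - u z))" for c
    unfolding right_diff_distrib conv_def using i[of c] Ji[of c] by simp
  have i': "integrable lborel (\<lambda>s. J (c - s) * (u s - u z))" for c
    unfolding right_diff_distrib using i[of c] Ji[of c] by simp
  have [measurable]: "J \<in> borel_measurable borel" "u \<in> borel_measurable borel"
    using ccs u by (auto intro: ccs_measurable)
  have "conv J u (y + k) - conv J u y
      = (LINT s|lborel. (J (y + k - s) - J (y - s)) * (u s - u z))"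
    unfolding left_diff_distrib using i' sub[of "y + k"] sub[of y] by simp
  also have "\<dots> = (LINT w|lborel. (J (y + k - (w + z)) - J (y - (w + z))) * (u (w + z) - u z))"
    by (rule lborel_integral_shift[symmetric]) measurable
  finally have "\<bar>conv J u (x + h) - conv J u x\<bar>
      = \<bar>LINT w|lborel. (J (y + k - (w + z)) - J (y - (w + z))) * (u (w + z) - u z)\<bar>"
    unfolding e by (rule arg_cong)
  also have "\<dots> \<le> (LINT w|lborel. \<bar>(J (y + k - (w + z)) - J (y - (w + z))) * (u (w + z) - u z)\<bar>)"
    by (rule integral_abs_bound)
  also have "\<dots> \<le> (LINT w|lborel. L * norm h * (indicator (cball 0 (R + 2)) w * \<bar>u (z + w) - u z\<bar>))"
  proof (rule integral_mono)
    obtain B where B: "B > 0" "\<And>x. \<bar>u x\<bar> \<le> B" using ccs_bounded[OF u(1)] by blast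
    have Bz: "\<bar>u (z + w) - u z\<bar> \<le> 2 * B" for w using B(2)[of "z + w"] B(2)[of z] by linarith
    have "integrable lborel (\<lambda>w. indicator (cball 0 (R + 2)) w * \<bar>u (z + w) - u z\<bar>)"
    proof (rule integrable_bounded_support[where B = "1 * (2 * B)" and r = "R + 2"])
      show "\<bar>indicator (cball 0 (R + 2)) w * \<bar>u (z + w) - u z\<bar>\<bar> \<le> 1 * (2 * B)" for w
        unfolding abs_mult using Bz[of w] by (intro mult_mono) (auto simp: indicator_def)
    qed (auto simp: indicator_def)
    then show "integrable lborel (\<lambda>w. L * norm h * (indicator (cball 0 (R + 2)) w * \<bar>u (z + w) - u z\<bar>))"
      by (rule integrable_mult_right)
    have "integrable lborel (\<lambda>s. (J (y + k - s) - J (y - s)) * (u s - u z))"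
      unfolding left_diff_distrib by (intro Bochner_Integration.integrable_diff i')
    then have "integrable (distr lborel borel ((+) z)) (\<lambda>s. (J (y + k - s) - J (y - s)) * (u s - u z))"
      by (simp add: lborel_distr_plus)
    then have "integrable lborel (\<lambda>w. (J (y + k - (z + w)) - J (y - (z + w))) * (u (z + w) - u z))"
      by (subst (asm) integrable_distr_eq) auto
    then show "integrable lborel (\<lambda>w. \<bar>(J (y + k - (w + z)) - J (y - (w + z))) * (u (w + z) - u z)\<bar>)"
      by (simp only: add.commute[of _ z]) (rule integrable_abs)
    fix w
    show "\<bar>(J (y + k - (w + z)) - J (y - (w + z))) * (u (w + z) - u z)\<bar>
      \<le> L * norm h * (indicator (cball 0 (R + 2)) w * \<bar>u (z + w) - u z\<bar>)"
    proof (cases "norm w \<le> R + 2")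
      case True
      have "\<bar>J (y + k - (w + z)) - J (y - (w + z))\<bar> \<le> L * norm h"
        using lip[of "y + k - (w + z)" "y - (w + z)"] nk by simp
      then show ?thesis
        using True by (simp add: abs_mult mult_right_mono add.commute)
    next
      case False
      \<comment> \<open>The radius R + 2 consists of \<open>R\<close> for the support of
        \<open>J\<close>, 1 for the distance from \<open>y\<close> to \<open>z\<close>, and 1 for
        the increment \<open>k\<close>.\<close>
      have "w = (y - z) - (y - (w + z))" by simp
      then have "norm w \<le> norm (y - z) + norm (y - (w + z))" by (metis norm_triangle_ineq4)
      then have "norm (y - (w + z)) > R" using False yz by linarith
      moreover
      have "w = (y - z) + k - (y + k - (w + z))" by simp
      then have "norm w \<le> norm ((y - z) + k) + norm (y + k - (w + z))" by (metis norm_triangle_ineq4)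
      then have "norm (y + k - (w + z)) > R"
        using False yz nk h norm_triangle_ineq[of "y - z" k] by linarith
      ultimately show ?thesis using supp False by simp
    qed
  qed
  also have "\<dots> = L * norm h * (LINT w|lborel. indicator (cball 0 (R + 2)) w * \<bar>u (z + w) - u z\<bar>)"
    by (rule integral_mult_right_zero)
  finally show ?thesis .
qed

text \<open>For large \<open>x\<close> the pointwise bound is averaged over \<open>z\<close> in the
  sector at radius \<open>norm x\<close>; for bounded \<open>x\<close> the uniform Lipschitz bound
  suffices, with the bounded power of the norm absorbed into the constant.\<close>

lemma conv_power_increment:
  fixes J :: "'a::euclidean_space \<Rightarrow> real"
  assumes ccs: "ccs J" and nonneg: "\<And>x. J x \<ge> 0" and int: "(LINT x|lborel. J x) = 1"
    and rad: "radially_symmetric J" and lip: "\<And>x y. \<bar>J x - J y\<bar> \<le> L * norm (x - y)"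
  obtains C where "C > 0" "\<And>k x h. x \<noteq> 0 \<Longrightarrow> norm h \<le> 1 \<Longrightarrow>
    \<bar>conv_power J k (x + h) - conv_power J k x\<bar> \<le> C * (real k + 1) * norm h / norm x ^ (DIM('a) + 3)"
proof -
  have even: "J (- x) = J x" for x
    using rad unfolding radially_symmetric_def by (metis norm_minus_cancel)
  obtain R where R: "R > 0" "\<And>x. norm x > R \<Longrightarrow> J x = 0"
    using ccs_support[OF ccs] by blast
  have "norm (SOME i::'a. i \<in> Basis) = 1" by (simp add: SOME_Basis)
  then have L: "L \<ge> 0"
    using lip[of "SOME i::'a. i \<in> Basis" 0] abs_ge_zero order.trans by fastforce
  obtain a C0 r0 where a: "a \<noteq> 0" and C0: "C0 > 0" and r0: "r0 \<ge> 1" and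
    shell: "\<And>r k w. r \<ge> r0 \<Longrightarrow> norm w \<le> R + 2 \<Longrightarrow>
      (LINT x|lborel. indicator (shell_sector a r) x * \<bar>conv_power J k (x + w) - conv_power J k x\<bar>)
        \<le> C0 * (real k + 1) / r ^ 4"
    using conv_power_shell_increment[OF ccs nonneg even int, of "R + 2"] R(1) by auto
  obtain v where v: "v > 0" "\<And>r. r > 0 \<Longrightarrow> v * r ^ (DIM('a) - 1) \<le> measure lborel (shell_sector a r)"
    using measure_shell_sector_ge[OF a] by blast
  let ?N = "DIM('a)"
  let ?B = "cball (0::'a) (R + 2)"
  define b where "b = measure lborel ?B"
  \<comment> \<open>Beyond R + 1 both \<open>x\<close> and \<open>x + h\<close> lie outside the
    support of \<open>J\<close>; this settles \<open>k = 0\<close>, where no further convolution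
    factor is available.\<close>
  define r1 where "r1 = max r0 (R + 1)"
  define C where "C = 1 + L * r1 ^ (?N + 3) + L * b * C0 / v"
  have b: "b \<ge> 0" by (simp add: b_def)
  have r1: "r1 \<ge> 1" "r1 \<ge> r0" "r1 \<ge> R + 1" using r0 by (auto simp: r1_def)
  have C: "C > 0" "C \<ge> L * r1 ^ (?N + 3)" "C \<ge> L * b * C0 / v"
    using L r1 b C0 v by (auto simp: C_def intro!: add_pos_nonneg divide_nonneg_pos)
  have main: "\<bar>conv_power J (Suc k) (x + h) - conv_power J (Suc k) x\<bar>
      \<le> L * b * C0 / v * ((real k + 1) * norm h / norm x ^ (?N + 3))"
    if h: "norm h \<le> 1" and x: "norm x > r1" for k x h
  proof -
    let ?u = "conv_power J k" and ?r = "norm x"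
    let ?D = "shell_sector a ?r"
    let ?d = "\<bar>conv J ?u (x + h) - conv J ?u x\<bar>"
    have xr: "?r > 0" "?r \<ge> r0" using x r1 by auto
    have u: "ccs ?u" "radially_symmetric ?u"
      by (intro ccs_conv_power radially_symmetric_conv_power ccs rad)+
    have [measurable]: "?u \<in> borel_measurable borel" by (rule ccs_measurable[OF u(1)])
    obtain M where M: "M > 0" "\<And>x. \<bar>?u x\<bar> \<le> M" using ccs_bounded[OF u(1)] by blast
    let ?F = "\<lambda>z w. indicator ?D z * (indicator ?B w * \<bar>?u (z + w) - ?u z\<bar>)"
    have F1: "case_prod ?F \<in> borel_measurable borel"
    proof -
      have "?D \<times> ?B \<in> sets (borel \<Otimes>\<^sub>M borel)"
        by (intro pair_measureI shell_sector_sets) auto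
      then have "?D \<times> ?B \<in> sets borel" by (simp only: borel_prod)
      moreover have "(\<lambda>p::'a \<times> 'a. \<bar>?u (fst p + snd p) - ?u (fst p)\<bar>) \<in> borel_measurable borel"
        by (intro borel_measurable_continuous_onI continuous_intros
            continuous_on_compose2[OF ccs_continuous[OF u(1)]]) auto
      ultimately have "(\<lambda>p. indicator (?D \<times> ?B) p * \<bar>?u (fst p + snd p) - ?u (fst p)\<bar>) \<in> borel_measurable borel"
        by (intro borel_measurable_times borel_measurable_indicator)
      also have "(\<lambda>p. indicator (?D \<times> ?B) p * \<bar>?u (fst p + snd p) - ?u (fst p)\<bar>) = case_prod ?F"
        by (auto simp: fun_eq_iff indicator_def)
      finally show ?thesis .
    qed
    have F2: "\<bar>?F z w\<bar> \<le> 1 * (1 * (2 * M))" for z w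
      using M(2)[of "z + w"] M(2)[of z] unfolding abs_mult
      by (intro mult_mono) (auto simp: indicator_def)
    have F3: "?F z w = 0" if "norm z > ?r + 1 + (R + 2) \<or> norm w > ?r + 1 + (R + 2)" for z w
    proof -
      have "z \<notin> ?D \<or> w \<notin> ?B"
        using that R(1) norm_ge_zero[of x] unfolding shell_sector_def mem_cball_0 mem_Collect_eq by linarith
      then show ?thesis by auto
    qed
    have bD: "bounded ?D"
      by (rule bounded_subset[of "cball 0 (?r + 1)"]) (auto simp: shell_sector_def)
    have iD: "integrable lborel (indicator ?D :: 'a \<Rightarrow> real)"
      using emeasure_bounded_finite[OF bD] by (intro integrable_real_indicator) auto
    have iB: "integrable lborel (indicator ?B :: 'a \<Rightarrow> real)"
      using emeasure_bounded_finite[OF bounded_cball] by (intro integrable_real_indicator) auto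
    have "measure lborel ?D * ?d = (LINT z|lborel. indicator ?D z * ?d)"
      by simp
    also have "\<dots> \<le> (LINT z|lborel. L * norm h * (LINT w|lborel. ?F z w))"
    proof (rule integral_mono)
      show "integrable lborel (\<lambda>z. indicator ?D z * ?d)" using iD by simp
      show "integrable lborel (\<lambda>z. L * norm h * (LINT w|lborel. ?F z w))"
        by (intro integrable_mult_right lborel_Fubini_bounded(2)[OF F1 F2 F3])
      fix z
      show "indicator ?D z * ?d \<le> L * norm h * (LINT w|lborel. ?F z w)"
      proof (cases "z \<in> ?D")
        case True
        then have "?r \<le> norm z" "norm z \<le> ?r + 1" by (auto simp: shell_sector_def)
        from conv_power_increment_shell[OF ccs int rad lip R(2) u xr(1) h this]
        show ?thesis using True by simp
      qed simp
    qed
    also have "\<dots> = L * norm h * (LINT z|lborel. LINT w|lborel. ?F z w)"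
      by (rule integral_mult_right_zero)
    \<comment> \<open>With \<open>w\<close> outermost, the inner integral over the sector is the
      shell estimate for the fixed increment \<open>w\<close>.\<close>
    also have "(LINT z|lborel. LINT w|lborel. ?F z w) = (LINT w|lborel. LINT z|lborel. ?F z w)"
      by (rule lborel_Fubini_bounded(1)[OF F1 F2 F3])
    also have "\<dots> \<le> (LINT w|lborel. indicator ?B w * (C0 * (real k + 1) / ?r ^ 4))"
    proof (rule integral_mono')
      show "integrable lborel (\<lambda>w. indicator ?B w * (C0 * (real k + 1) / ?r ^ 4))" using iB by simp
      fix w
      have "(LINT z|lborel. ?F z w) = indicator ?B w * (LINT z|lborel. indicator ?D z * \<bar>?u (z + w) - ?u z\<bar>)"
        by (cases "w \<in> ?B") auto
      also have "\<dots> \<le> indicator ?B w * (C0 * (real k + 1) / ?r ^ 4)"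
        using shell[OF xr(2), of w k] by (cases "w \<in> ?B") auto
      finally show "(LINT z|lborel. ?F z w) \<le> indicator ?B w * (C0 * (real k + 1) / ?r ^ 4)" .
      show "0 \<le> indicator ?B w * (C0 * (real k + 1) / ?r ^ 4)"
        using C0 xr by (intro mult_nonneg_nonneg divide_nonneg_nonneg) auto
    qed
    also have "\<dots> = b * (C0 * (real k + 1) / ?r ^ 4)" by (simp add: b_def)
    finally have "measure lborel ?D * ?d \<le> L * norm h * (b * (C0 * (real k + 1) / ?r ^ 4))"
      using L by (simp add: mult_left_mono)
    moreover have "v * ?r ^ (?N - 1) * ?d \<le> measure lborel ?D * ?d"
      using v(2)[OF xr(1)] by (intro mult_right_mono) auto
    ultimately have "?d * (v * ?r ^ (?N - 1)) \<le> L * norm h * (b * (C0 * (real k + 1) / ?r ^ 4))"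
      by (simp add: mult.commute)
    moreover have "v * ?r ^ (?N - 1) > 0" using v xr by simp
    ultimately have "?d \<le> L * norm h * (b * (C0 * (real k + 1) / ?r ^ 4)) / (v * ?r ^ (?N - 1))"
      by (simp only: pos_le_divide_eq)
    also have "\<dots> = L * b * C0 / v * ((real k + 1) * norm h / (?r ^ (?N - 1) * ?r ^ 4))"
      by (simp add: mult_ac)
    also have "?r ^ (?N - 1) * ?r ^ 4 = ?r ^ (?N + 3)"
    proof -
      have "?N - 1 + 4 = ?N + 3" using DIM_positive[where 'a = 'a] by linarith
      then show ?thesis by (metis power_add)
    qed
    finally show ?thesis by simp
  qed
  have "\<bar>conv_power J k (x + h) - conv_power J k x\<bar> \<le> C * (real k + 1) * norm h / norm x ^ (?N + 3)"
    if x: "x \<noteq> 0" and h: "norm h \<le> 1" for k x h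
  proof (cases "norm x \<le> r1")
    case True
    have "\<bar>conv_power J k (x + h) - conv_power J k x\<bar> \<le> L * norm h"
      using conv_power_Lipschitz[OF ccs nonneg int lip, of k "x + h" x] by simp
    moreover have "L * norm h * norm x ^ (?N + 3) \<le> C * (real k + 1) * norm h"
    proof -
      have "L * norm h * norm x ^ (?N + 3) \<le> L * norm h * r1 ^ (?N + 3)"
        using True L by (intro mult_left_mono power_mono) auto
      also have "\<dots> = L * r1 ^ (?N + 3) * 1 * norm h" by simp
      also have "\<dots> \<le> C * (real k + 1) * norm h"
        using C by (intro mult_right_mono mult_mono) auto
      finally show ?thesis .
    qed
    then have "L * norm h \<le> C * (real k + 1) * norm h / norm x ^ (?N + 3)"
      using x by (simp add: pos_le_divide_eq)
    ultimately show ?thesis by linarith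
  next
    case False
    show ?thesis
    proof (cases k)
      case 0
      have "norm (x + h) > R" "norm x > R"
        using False r1 h norm_triangle_ineq4[of "x + h" h] by auto
      then show ?thesis using R(2) C 0 by simp
    next
      case (Suc i)
      have "\<bar>conv_power J k (x + h) - conv_power J k x\<bar>
          \<le> L * b * C0 / v * ((real i + 1) * norm h / norm x ^ (?N + 3))"
        using main[OF h, of x i] False Suc by simp
      also have "\<dots> \<le> C * ((real k + 1) * norm h / norm x ^ (?N + 3))"
        using C Suc by (intro mult_mono divide_right_mono mult_right_mono) auto
      finally show ?thesis by (simp add: mult.assoc)
    qed
  qed
  with C(1) show ?thesis using that by blast
qed

subsection \<open>From the convolution powers to the fundamental solution\<close>

lemma smooth_compact_support_ccs:
  assumes "smooth_compact_support J"
  shows "ccs J"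
proof -
  have "C_k_on 0 UNIV J" using assms unfolding smooth_compact_support_def smooth_on_def by blast
  moreover have "bounded (closure {x. J x \<noteq> 0})"
    using assms compact_imp_bounded unfolding smooth_compact_support_def by blast
  then obtain r where r: "\<And>x. x \<in> closure {x. J x \<noteq> 0} \<Longrightarrow> norm x \<le> r"
    unfolding bounded_iff by blast
  have "J x = 0" if "norm x > r" for x
  proof (rule ccontr)
    assume "J x \<noteq> 0"
    then have "x \<in> closure {x. J x \<noteq> 0}" using closure_subset[of "{x. J x \<noteq> 0}"] by blast
    then show False using r[of x] that by simp
  qed
  ultimately show ?thesis by (intro ccsI[of _ r]) auto
qed

lemma smooth_compact_support_Lipschitz:
  fixes J :: "'a::euclidean_space \<Rightarrow> real"
  assumes "smooth_compact_support J"
  obtains L where "\<And>x y. \<bar>J x - J y\<bar> \<le> L * norm (x - y)"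
proof -
  have C1: "C_k_on (Suc 0) UNIV J" using assms unfolding smooth_compact_support_def smooth_on_def by blast
  then have diff: "J differentiable (at x)" for x by simp
  let ?D = "\<lambda>x. frechet_derivative J (at x)"
  have der: "(J has_derivative ?D x) (at x)" for x
    using diff frechet_derivative_works by blast
  obtain r where r: "r > 0" "\<And>x. norm x > r \<Longrightarrow> J x = 0"
    using ccs_support[OF smooth_compact_support_ccs[OF assms]] by blast
  have D0: "?D x = (\<lambda>v. 0)" if "norm x > r" for x
  proof -
    have "((\<lambda>x. 0) has_derivative (\<lambda>v. 0)) (at x)" by simp
    then have "(J has_derivative (\<lambda>v. 0)) (at x)"
    proof (rule has_derivative_transform_within_open)
      show "open {x::'a. r < norm x}" by (intro open_Collect_less continuous_intros)
    qed (use that r in auto)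
    then show ?thesis using frechet_derivative_at by metis
  qed
  have "ccs (\<lambda>x. ?D x v)" for v
    by (rule ccsI[of _ r]) (use C1 D0 in auto)
  then have "\<exists>B. \<forall>x. \<bar>?D x v\<bar> \<le> B" for v
    using ccs_bounded by metis
  then obtain B where B: "\<And>v x. \<bar>?D x v\<bar> \<le> B v" by metis
  define L where "L = (\<Sum>b\<in>Basis. B b)"
  have "onorm (?D x) \<le> L" for x
  proof (rule onorm_le)
    fix v :: 'a
    have lin: "linear (?D x)" using der has_derivative_linear by blast
    have "?D x v = ?D x (\<Sum>b\<in>Basis. (v \<bullet> b) *\<^sub>R b)" by (simp add: euclidean_representation)
    also have "\<dots> = (\<Sum>b\<in>Basis. (v \<bullet> b) * ?D x b)"
      by (simp add: linear_sum[OF lin] linear_scale[OF lin])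
    finally have "\<bar>?D x v\<bar> \<le> (\<Sum>b\<in>Basis. \<bar>(v \<bullet> b) * ?D x b\<bar>)" by simp
    also have "\<dots> \<le> (\<Sum>b\<in>Basis. norm v * B b)"
      unfolding abs_mult by (intro sum_mono mult_mono B Basis_le_norm) auto
    finally show "norm (?D x v) \<le> L * norm v" by (simp add: L_def sum_distrib_left mult.commute)
  qed
  then have "\<bar>J x - J y\<bar> \<le> L * norm (x - y)" for x y
    using differentiable_bound[of UNIV J ?D L x y] der by simp
  then show ?thesis using that by blast
qed

section \<open>Duhamel iteration for the fundamental solution\<close>

lemma abs_conv_le:
  assumes "ccs J" "\<And>x. J x \<ge> 0" "(LINT x|lborel. J x) = 1" "continuous_on UNIV g" "\<And>x. \<bar>g x\<bar> \<le> B"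
  shows "\<bar>conv J g x\<bar> \<le> B"
proof -
  have i: "integrable lborel (\<lambda>y. J (x - y) * B)"
    using ccs_integrable[OF ccs_flip[OF assms(1)]] by simp
  have "\<bar>conv J g x\<bar> \<le> (LINT y|lborel. \<bar>J (x - y) * g y\<bar>)"
    unfolding conv_def by (rule integral_abs_bound)
  also have "\<dots> \<le> (LINT y|lborel. J (x - y) * B)"
    by (rule integral_mono[OF integrable_abs[OF conv_integrable[OF assms(1,4)]] i])
       (use assms in \<open>auto simp: abs_mult intro!: mult_left_mono\<close>)
  also have "\<dots> = B"
    using lborel_integral_flip[OF ccs_measurable[OF assms(1)], of x] assms(3) by simp
  finally show ?thesis .
qed

lemma nonlocal_op_eq_conv:
  assumes "ccs J" "(LINT x|lborel. J x) = 1" "continuous_on UNIV u"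
  shows "nonlocal_op J u x = conv J u x - u x"
  unfolding nonlocal_op_def conv_def right_diff_distrib
  using conv_integrable[OF assms(1,3), of x] ccs_integrable[OF ccs_flip[OF assms(1)], of x]
    lborel_integral_flip[OF ccs_measurable[OF assms(1)], of x] assms(2)
  by simp

text \<open>Duhamel iteration: \<open>w = exp t * W\<close> solves \<open>w' = J * w + J\<close>, \<open>w(0) = 0\<close>.\<close>

lemma fundamental_series_remainder:
  fixes J :: "'a::euclidean_space \<Rightarrow> real"
  assumes ccs: "ccs J" and nonneg: "\<And>x. J x \<ge> 0" and int: "(LINT x|lborel. J x) = 1"
    and W: "fundamental_smooth_part J W" and T: "T > 0"
  obtains A where "\<And>n x t. 0 \<le> t \<Longrightarrow> t \<le> T \<Longrightarrow>
    \<bar>exp t * W x t - (\<Sum>k<n. t ^ Suc k / fact (Suc k) * conv_power J k x)\<bar> \<le> A * (t ^ n / fact n)"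
proof -
  let ?w = "\<lambda>x t. exp t * W x t"
  let ?S = "\<lambda>n x t. \<Sum>k<n. t ^ Suc k / fact (Suc k) * conv_power J k x"
  let ?E = "\<lambda>n x t. ?w x t - ?S n x t"
  have "bounded ((\<lambda>(x, t). W x t) ` (UNIV \<times> {0..T}))"
    using W T by (simp add: fundamental_smooth_part_def)
  then obtain M where M: "\<And>p. p \<in> UNIV \<times> {0..T} \<Longrightarrow> \<bar>(\<lambda>(x, t). W x t) p\<bar> \<le> M"
    unfolding bounded_iff by auto
  have cW: "continuous_on (UNIV \<times> {0..}) (\<lambda>(x, t). W x t)"
    using W by (simp add: fundamental_smooth_part_def)
  have cx: "continuous_on UNIV (\<lambda>x. W x t)" if "t \<ge> 0" for t
    using continuous_on_compose2[OF cW, of UNIV "\<lambda>x. (x, t)"] that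
    by (auto simp: continuous_on_Pair continuous_on_id continuous_on_const)
  have ct: "continuous_on {0..} (\<lambda>t. W x t)" for x
    using continuous_on_compose2[OF cW, of "{0..}" "\<lambda>t. (x, t)"]
    by (auto simp: continuous_on_Pair continuous_on_id continuous_on_const)
  have cp: "continuous_on UNIV (conv_power J k)" for k
    by (rule ccs_continuous[OF ccs_conv_power[OF ccs]])
  have cE: "continuous_on UNIV (\<lambda>x. ?E n x t)" if "t \<ge> 0" for n t
    by (intro continuous_intros cx cp that)
  have derW: "((\<lambda>s. W x s) has_real_derivative conv J (\<lambda>y. W y t) x - W x t + exp (- t) * J x) (at t)"
    if "t > 0" for x t
  proof -
    have "((\<lambda>s. W x s) has_real_derivative nonlocal_op J (\<lambda>y. W y t) x + exp (- t) * J x) (at t)"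
      using W that unfolding fundamental_smooth_part_def by blast
    then show ?thesis
      using nonlocal_op_eq_conv[OF ccs int cx[of t], of x] that by simp
  qed
  \<comment> \<open>The remainders satisfy a recursion without source: the term \<open>J\<close> in
    the equation for \<open>exp t * W\<close> cancels the derivative of the summand
    \<open>k = 0\<close>.\<close>
  have derE: "((\<lambda>s. ?E (Suc n) x s) has_real_derivative conv J (\<lambda>y. ?E n y t) x) (at t)"
    if t: "t > 0" for n x t
  proof -
    have dw: "((\<lambda>s. ?w x s) has_real_derivative
        exp t * W x t + exp t * (conv J (\<lambda>y. W y t) x - W x t + exp (- t) * J x)) (at t)"
      by (rule derivative_eq_intros derW t | simp)+
    have "((\<lambda>s. s ^ Suc k / fact (Suc k) * c) has_real_derivative t ^ k / fact k * c) (at t)" for k c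
    proof -
      have "((\<lambda>s. s ^ Suc k / fact (Suc k) * c) has_real_derivative
          (1 + real k) * t ^ k / fact (Suc k) * c) (at t)"
        by (rule derivative_eq_intros | simp)+
      moreover have "(1 + real k) * t ^ k / fact (Suc k) = t ^ k / fact k"
        by (simp add: divide_simps)
      ultimately show ?thesis by simp
    qed
    then have dS: "((\<lambda>s. ?S (Suc n) x s) has_real_derivative (\<Sum>k<Suc n. t ^ k / fact k * conv_power J k x)) (at t)"
      by (intro DERIV_sum)
    have "conv J (\<lambda>y. ?E n y t) x = conv J (\<lambda>y. exp t * W y t) x - conv J (\<lambda>y. ?S n y t) x"
    proof -
      have "conv J (\<lambda>y. exp t * W y t + - 1 * ?S n y t) x
          = conv J (\<lambda>y. exp t * W y t) x + conv J (\<lambda>y. - 1 * ?S n y t) x"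
        using t by (intro conv_add_right ccs continuous_intros cx cp) auto
      then show ?thesis unfolding conv_cmult_right by simp
    qed
    also have "conv J (\<lambda>y. exp t * W y t) x = exp t * conv J (\<lambda>y. W y t) x"
      by (rule conv_cmult_right)
    also have "conv J (\<lambda>y. ?S n y t) x = (\<Sum>k<n. t ^ Suc k / fact (Suc k) * conv_power J (Suc k) x)"
      by (subst conv_sum_right, (intro ccs finite_lessThan continuous_intros cp)+)
         (simp only: conv_cmult_right conv_power.simps)
    also have "exp t * conv J (\<lambda>y. W y t) x - (\<Sum>k<n. t ^ Suc k / fact (Suc k) * conv_power J (Suc k) x)
      = exp t * W x t + exp t * (conv J (\<lambda>y. W y t) x - W x t + exp (- t) * J x)
        - (\<Sum>k<Suc n. t ^ k / fact k * conv_power J k x)"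
      unfolding sum.lessThan_Suc_shift by (simp add: algebra_simps exp_minus)
    finally show ?thesis using DERIV_diff[OF dw dS] by simp
  qed
  define A where "A = exp T * M"
  have "\<bar>?E n x t\<bar> \<le> A * (t ^ n / fact n)" if "0 \<le> t" "t \<le> T" for n x t
    using that
  proof (induction n arbitrary: x t)
    case 0
    then show ?case using M[of "(x, t)"] by (auto simp: A_def abs_mult intro!: mult_mono)
  next
    case (Suc n)
    show ?case
    proof (cases "t = 0")
      case True
      then show ?thesis using W by (simp add: fundamental_smooth_part_def)
    next
      case False
      let ?\<phi> = "\<lambda>s. A * (s ^ Suc n / fact (Suc n))"
      \<comment> \<open>The equation holds for positive times only, so the mean value inequality is
        used in the form that needs just continuity at the endpoint 0.\<close>
      have "norm (?E (Suc n) x t - ?E (Suc n) x 0) \<le> ?\<phi> t - ?\<phi> 0"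
      proof (rule differentiable_bound_general)
        show "0 < t" using False Suc by simp
        show "continuous_on {0..t} (\<lambda>s. ?E (Suc n) x s)"
          by (intro continuous_intros continuous_on_subset[OF ct]) auto
        show "continuous_on {0..t} ?\<phi>" by (intro continuous_intros) auto
        fix s assume s: "0 < s" "s < t"
        show "((\<lambda>s. ?E (Suc n) x s) has_vector_derivative conv J (\<lambda>y. ?E n y s) x) (at s)"
          using derE[OF s(1), of x n] by (simp add: has_real_derivative_iff_has_vector_derivative)
        have "(?\<phi> has_real_derivative A * ((1 + real n) * s ^ n / fact (Suc n))) (at s)"
          by (rule derivative_eq_intros | simp)+
        moreover have "(1 + real n) * s ^ n / fact (Suc n) = s ^ n / fact n"
          by (simp add: divide_simps)
        ultimately have "(?\<phi> has_real_derivative A * (s ^ n / fact n)) (at s)" by simp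
        then show "(?\<phi> has_vector_derivative A * (s ^ n / fact n)) (at s)"
          by (simp only: has_real_derivative_iff_has_vector_derivative)
        have "\<bar>conv J (\<lambda>y. ?E n y s) x\<bar> \<le> A * (s ^ n / fact n)"
          using s Suc by (intro abs_conv_le ccs nonneg int cE Suc.IH) auto
        then show "norm (conv J (\<lambda>y. ?E n y s) x) \<le> A * (s ^ n / fact n)" by simp
      qed
      then show ?thesis using W by (simp add: fundamental_smooth_part_def)
    qed
  qed
  then show ?thesis using that by blast
qed

text \<open>The factor k+1 lowers the factorial: the partial sums differ by at most c t times a
  partial sum of exp(t). The remainders tend to 0 with \<open>n\<close>, and exp(t) cancels.\<close>

lemma fundamental_smooth_part_increment:
  fixes J :: "'a::euclidean_space \<Rightarrow> real"
  assumes ccs: "ccs J" and nonneg: "\<And>x. J x \<ge> 0" and int: "(LINT x|lborel. J x) = 1"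
    and W: "fundamental_smooth_part J W" and t: "t > 0" and c: "c \<ge> 0"
    and incr: "\<And>k. \<bar>conv_power J k (x + h) - conv_power J k x\<bar> \<le> c * (real k + 1)"
  shows "\<bar>W (x + h) t - W x t\<bar> \<le> c * t"
proof -
  obtain A where A: "\<And>n x s. 0 \<le> s \<Longrightarrow> s \<le> t \<Longrightarrow>
    \<bar>exp s * W x s - (\<Sum>k<n. s ^ Suc k / fact (Suc k) * conv_power J k x)\<bar> \<le> A * (s ^ n / fact n)"
    using fundamental_series_remainder[OF ccs nonneg int W t] by blast
  let ?S = "\<lambda>n x. \<Sum>k<n. t ^ Suc k / fact (Suc k) * conv_power J k x"
  have bound: "\<bar>exp t * W (x + h) t - exp t * W x t\<bar> \<le> 2 * A * (t ^ n / fact n) + c * t * exp t" for n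
  proof -
    have "?S n (x + h) - ?S n x
        = (\<Sum>k<n. t ^ Suc k / fact (Suc k) * (conv_power J k (x + h) - conv_power J k x))"
      by (simp add: sum_subtractf right_diff_distrib)
    also have "\<bar>\<dots>\<bar> \<le> (\<Sum>k<n. t ^ Suc k / fact (Suc k) * (c * (real k + 1)))"
      using t by (intro order.trans[OF sum_abs] sum_mono)
        (simp only: abs_mult, intro mult_mono incr, auto)
    also have "\<dots> = c * t * (\<Sum>k<n. t ^ k / fact k)"
      unfolding sum_distrib_left by (intro sum.cong refl) (simp add: divide_simps)
    also have "\<dots> \<le> c * t * exp t"
    proof -
      have "(\<Sum>k<n. t ^ k / fact k) \<le> exp t"
        using sum_le_suminf[OF summable_exp[of t], of "{..<n}"] t
        by (simp add: exp_def divide_inverse mult.commute)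
      then show ?thesis using c t by (intro mult_left_mono) auto
    qed
    finally show ?thesis
      using A[of t "x + h" n] A[of t x n] t by linarith
  qed
  have "(\<lambda>n. 2 * A * (t ^ n / fact n) + c * t * exp t) \<longlonglongrightarrow> 2 * A * 0 + c * t * exp t"
    using summable_LIMSEQ_zero[OF summable_exp[of t]]
    by (intro tendsto_intros) (simp add: divide_inverse mult.commute)
  then have "\<bar>exp t * W (x + h) t - exp t * W x t\<bar> \<le> c * t * exp t"
    by (intro tendsto_lowerbound[of _ _ sequentially]) (use bound in auto)
  moreover have "\<bar>exp t * W (x + h) t - exp t * W x t\<bar> = \<bar>W (x + h) t - W x t\<bar> * exp t"
    unfolding right_diff_distrib[symmetric] abs_mult by simp
  ultimately show ?thesis by simp
qed

lemma gderiv_norm_le: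
  fixes f :: "'a::euclidean_space \<Rightarrow> real"
  assumes "f differentiable (at x)" and lip: "\<And>h. norm h \<le> 1 \<Longrightarrow> \<bar>f (x + h) - f x\<bar> \<le> c * norm h"
    and c: "c \<ge> 0"
  obtains D where "GDERIV f x :> D" "norm D \<le> c"
proof -
  obtain f' where f': "(f has_derivative f') (at x)"
    using assms(1) unfolding differentiable_def by blast
  then have lin: "linear f'" by (rule has_derivative_linear)
  define D where "D = (\<Sum>b\<in>Basis. f' b *\<^sub>R b)"
  have fD: "f' h = h \<bullet> D" for h
  proof -
    have "f' h = f' (\<Sum>b\<in>Basis. (h \<bullet> b) *\<^sub>R b)" by (simp add: euclidean_representation)
    also have "\<dots> = (\<Sum>b\<in>Basis. (h \<bullet> b) * f' b)"
      by (simp add: linear_sum[OF lin] linear_scale[OF lin])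
    finally show ?thesis by (simp add: D_def inner_sum_right mult.commute)
  qed
  have "GDERIV f x :> D"
    using f' fD unfolding gderiv_def by (metis (no_types, lifting) ext)
  moreover have "norm D \<le> c"
  proof -
    \<comment> \<open>The directional derivative along the normalised gradient is its norm;
      \<open>sgn 0 = 0\<close> covers a vanishing gradient.\<close>
    define v where "v = sgn D"
    have v: "norm v \<le> 1" by (simp add: v_def norm_sgn)
    have "((\<lambda>s. x + s *\<^sub>R v) has_derivative (\<lambda>s. s *\<^sub>R v)) (at 0)"
      by (auto intro!: derivative_eq_intros)
    from has_derivative_compose[OF this, of f f']
    have "((\<lambda>s. f (x + s *\<^sub>R v)) has_derivative (\<lambda>s. f' (s *\<^sub>R v))) (at 0)"
      using f' by simp
    moreover have "(\<lambda>s. f' (s *\<^sub>R v)) = (*) (f' v)"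
      by (simp add: fun_eq_iff linear_scale[OF lin])
    ultimately have "((\<lambda>s. f (x + s *\<^sub>R v)) has_real_derivative f' v) (at 0)"
      by (simp only: has_field_derivative_def)
    then have "((\<lambda>s. (f (x + s *\<^sub>R v) - f x) / s) \<longlongrightarrow> f' v) (at 0)"
      by (simp add: DERIV_def)
    moreover have "eventually (\<lambda>s. (f (x + s *\<^sub>R v) - f x) / s \<le> c) (at 0)"
    proof -
      have "(f (x + s *\<^sub>R v) - f x) / s \<le> c" if "s \<noteq> 0" "dist s 0 < 1" for s
      proof -
        have sv: "norm (s *\<^sub>R v) \<le> \<bar>s\<bar>" using v by (simp add: mult_left_le)
        then have "norm (s *\<^sub>R v) \<le> 1" using that(2) unfolding dist_real_def by linarith
        then have "\<bar>f (x + s *\<^sub>R v) - f x\<bar> \<le> c * norm (s *\<^sub>R v)" by (rule lip)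
        also have "\<dots> \<le> c * \<bar>s\<bar>" using sv c by (rule mult_left_mono)
        finally have "\<bar>(f (x + s *\<^sub>R v) - f x) / s\<bar> \<le> c"
          using that(1) by (simp add: pos_divide_le_eq)
        then show ?thesis by linarith
      qed
      then show ?thesis unfolding eventually_at by (intro exI[of _ 1]) auto
    qed
    ultimately have "f' v \<le> c" by (rule tendsto_upperbound) simp
    moreover have "f' v = norm D"
      by (cases "D = 0") (simp_all add: fD v_def sgn_div_norm power2_norm_eq_inner[symmetric] power2_eq_square)
    ultimately show ?thesis by simp
  qed
  ultimately show ?thesis using that by blast
qed

theorem theorem2p2:
  fixes J :: "real ^ 'n \<Rightarrow> real"
  assumes "smooth_compact_support J"
    and "radially_symmetric J"
    and "\<forall>x. J x \<ge> 0"
    and "(LINT x|lborel. J x) = 1"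
  shows "\<exists>C>0. \<forall>W. fundamental_smooth_part J W \<longrightarrow>
           (\<forall>x t. x \<noteq> 0 \<longrightarrow> t > 0 \<longrightarrow>
              (\<exists>D. GDERIV (\<lambda>y. W y t) x :> D \<and>
                   norm D \<le> C * (t / norm x ^ (CARD('n) + 3))))"
proof -
  have ccs: "ccs J" by (rule smooth_compact_support_ccs[OF assms(1)])
  have nonneg: "\<And>x. J x \<ge> 0" using assms(3) by blast
  obtain L where lip: "\<And>x y. \<bar>J x - J y\<bar> \<le> L * norm (x - y)"
    using smooth_compact_support_Lipschitz[OF assms(1)] by blast
  obtain C where C: "C > 0" and incr: "\<And>k x h. x \<noteq> 0 \<Longrightarrow> norm h \<le> 1 \<Longrightarrow>
    \<bar>conv_power J k (x + h) - conv_power J k x\<bar> \<le> C * (real k + 1) * norm h / norm x ^ (CARD('n) + 3)"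
    using conv_power_increment[OF ccs nonneg assms(4,2) lip] by auto
  have "\<exists>D. GDERIV (\<lambda>y. W y t) x :> D \<and> norm D \<le> C * (t / norm x ^ (CARD('n) + 3))"
    if W: "fundamental_smooth_part J W" and x: "x \<noteq> 0" and t: "t > 0" for W x t
  proof -
    have "C_k_on (Suc 0) (UNIV \<times> {0<..}) (\<lambda>(x, t). W x t)"
      using W unfolding fundamental_smooth_part_def smooth_on_def by blast
    then have "(\<lambda>(x, t). W x t) differentiable (at (x, t))"
      using t by simp
    then obtain F where F: "((\<lambda>(x, t). W x t) has_derivative F) (at (x, t))"
      unfolding differentiable_def by blast
    have "((\<lambda>y. (y, t)) has_derivative (\<lambda>h. (h, 0))) (at x)"
      by (auto intro!: derivative_eq_intros)
    from has_derivative_compose[OF this, of "\<lambda>(x, t). W x t" F] F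
    have diff: "(\<lambda>y. W y t) differentiable (at x)"
      unfolding differentiable_def by auto
    have "\<bar>W (x + h) t - W x t\<bar> \<le> C * (t / norm x ^ (CARD('n) + 3)) * norm h" if h: "norm h \<le> 1" for h
    proof -
      \<comment> \<open>For fixed \<open>h\<close>, the constant \<open>c\<close> of the increment
        lemma includes the factor \<open>norm h\<close>, which makes the bound linear in
        \<open>h\<close>.\<close>
      have "\<bar>W (x + h) t - W x t\<bar> \<le> C * norm h / norm x ^ (CARD('n) + 3) * t"
        using C incr[OF x h]
        by (intro fundamental_smooth_part_increment[OF ccs nonneg assms(4) W t]) (auto simp: mult_ac)
      then show ?thesis by (simp add: mult_ac)
    qed
    then show ?thesis
      using gderiv_norm_le[OF diff, of "C * (t / norm x ^ (CARD('n) + 3))"] C t by auto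
  qed
  with C show ?thesis by blast
qed

end
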